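(* Let $A\in\mathbb{C}^{m\times n}$ be a standardized matrix (every row has unit $\ell_2$ norm) with full column rank, and let $y=|A\widehat{x}|^2$ (entrywise) for some $\widehat{x}\in\mathbb{C}^n$. Let $T=\{\Gamma_1,\dots,\Gamma_{N_b}\}$ be an $(N_b,\alpha,\beta)$ row paving of $A$ with $\alpha>0$ and $|\Gamma_r|\le n$ for every $\Gamma_r\in T$. For an arbitrary initial estimate $x_0\in\mathbb{C}^n$, the iterates $x_l$ $(l\ge 0)$ produced by the randomized block Kaczmarz method for phase retrieval with partition $T$, with the block selected uniformly at random in each iteration, satisfy $$\mathbb{E}\bigl[\operatorname{dist}^2(x_l,\widehat{x})\bigr]\le\Bigl(1-\frac{\sigma_{\min}^2(A)}{\beta N_b}\Bigr)^{l}\operatorname{dist}^2(x_0,\widehat{x})+\frac{4\beta}{\alpha\,\sigma_{\min}^2(A)}\|y\|_1 .$$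
   Context: For a set $\Gamma$ of row indices, $A_\Gamma$ is the submatrix of $A$ formed by the rows indexed by $\Gamma$, $y_\Gamma$ the corresponding subvector of $y$, and $A_\Gamma^\dagger$ the Moore–Penrose pseudo-inverse. $\sigma_{\min}(A)$ is the smallest singular value of $A$; for a block with $|\Gamma|\le n$, $\sigma_{\max}(A_\Gamma)$ and $\sigma_{\min}(A_\Gamma)$ are the largest and smallest of the $|\Gamma|$ singular values of $A_\Gamma$. An $(N_b,\alpha,\beta)$ row paving of $A$ is a partition $T=\{\Gamma_1,\dots,\Gamma_{N_b}\}$ of the row indices $\{1,\dots,m\}$ (into nonempty blocks) such that $\alpha\le\sigma_{\min}^2(A_{\Gamma_r})\le\sigma_{\max}^2(A_{\Gamma_r})\le\beta$ for each $\Gamma_r\in T$. The distance is $\operatorname{dist}(x,\widehat{x})=\min_{\theta\in[0,2\pi)}\|x-\widehat{x}e^{i\theta}\|_2$. The randomized block Kaczmarz method for phase retrieval: given the (deterministic) $x_0$, at each iteration $l=0,1,2,\dots$ a block $\Gamma_r\in T$ is drawn uniformly at random, independently of previous draws, and $$x_{l+1}=x_l+A_{\Gamma_r}^\dagger\bigl(\sqrt{y_{\Gamma_r}}\odot e^{i\theta_l}-A_{\Gamma_r}x_l\bigr),\qquad \theta_l=\angle(A_{\Gamma_r}x_l),$$ where $\angle$ is the entrywise argument in $[0,2\pi)$ with $\angle 0=0$ by convention, square root and exponential are entrywise ($i$ the imaginary unit), and $\odot$ is entrywise multiplication. The expectation is over all the random block selections. *)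

theory Defs
  imports
    "HOL-Probability.Probability"
    "HOL-Library.Disjoint_Sets"
    "Jordan_Normal_Form.Schur_Decomposition"
    "Jordan_Normal_Form.Spectral_Radius"
    "Jordan_Normal_Form.DL_Rank"
    "Jordan_Normal_Form.DL_Submatrix"
begin

text \<open>Vectors and matrices are those of \<^typ>\<open>'a Matrix.vec\<close> and \<^typ>\<open>'a mat\<close>, with
  rows and columns numbered from 0. The notation of the homonymous type-indexed vectors
  is switched off.\<close>

unbundle no vec_syntax
unbundle no inner_syntax

definition l2_norm :: "complex Matrix.vec \<Rightarrow> real" where
  "l2_norm v = sqrt (\<Sum>i<dim_vec v. (cmod (v $ i))\<^sup>2)"

definition l1_norm :: "real Matrix.vec \<Rightarrow> real" where
  "l1_norm v = (\<Sum>i<dim_vec v. \<bar>v $ i\<bar>)"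

definition row_block :: "complex mat \<Rightarrow> nat set \<Rightarrow> complex mat" where
  "row_block A \<Gamma> = submatrix A \<Gamma> UNIV"

text \<open>The entries keep their order (\<open>pick \<Gamma> i\<close> is the \<open>i\<close>-th smallest element of \<open>\<Gamma>\<close>),
  as in \<^const>\<open>submatrix\<close>.\<close>

definition subvec :: "'a Matrix.vec \<Rightarrow> nat set \<Rightarrow> 'a Matrix.vec" where
  "subvec v \<Gamma> = Matrix.vec (card {i. i < dim_vec v \<and> i \<in> \<Gamma>}) (\<lambda>i. v $ pick \<Gamma> i)"

definition is_pinv :: "complex mat \<Rightarrow> complex mat \<Rightarrow> bool" where
  "is_pinv A X \<longleftrightarrow>
     X \<in> carrier_mat (dim_col A) (dim_row A) \<and>
     A * X * A = A \<and> X * A * X = X \<and>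
     mat_adjoint (A * X) = A * X \<and> mat_adjoint (X * A) = X * A"

definition pinv :: "complex mat \<Rightarrow> complex mat" where
  "pinv A = (THE X. is_pinv A X)"

text \<open>An \<open>r \<times> c\<close> matrix has \<open>min r c\<close> singular values, the square roots of the eigenvalues
  of the smaller of its two Gram matrices; these eigenvalues are real and nonnegative.
  Multiplicities are irrelevant for the extreme singular values, so a set suffices.\<close>

definition singular_values :: "complex mat \<Rightarrow> real set" where
  "singular_values A =
     (\<lambda>k. sqrt (Re k)) ` spectrum
       (if dim_row A \<le> dim_col A then A * mat_adjoint A else mat_adjoint A * A)"

definition sigma_min :: "complex mat \<Rightarrow> real" where
  "sigma_min A = Min (singular_values A)"

definition sigma_max :: "complex mat \<Rightarrow> real" where
  "sigma_max A = Max (singular_values A)"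

definition row_paving :: "complex mat \<Rightarrow> nat \<Rightarrow> real \<Rightarrow> real \<Rightarrow> nat set set \<Rightarrow> bool" where
  "row_paving A N \<alpha> \<beta> T \<longleftrightarrow>
     partition_on {0..<dim_row A} T \<and> card T = N \<and>
     (\<forall>\<Gamma>\<in>T. \<alpha> \<le> (sigma_min (row_block A \<Gamma>))\<^sup>2 \<and>
            (sigma_min (row_block A \<Gamma>))\<^sup>2 \<le> (sigma_max (row_block A \<Gamma>))\<^sup>2 \<and>
            (sigma_max (row_block A \<Gamma>))\<^sup>2 \<le> \<beta>)"

text \<open>The infimum is attained, by periodicity and continuity in \<open>\<theta>\<close>, so it is the minimum.\<close>

definition phase_dist :: "complex Matrix.vec \<Rightarrow> complex Matrix.vec \<Rightarrow> real" where
  "phase_dist x z = (INF \<theta>\<in>{0..<2 * pi}. l2_norm (x - exp (\<i> * complex_of_real \<theta>) \<cdot>\<^sub>v z))"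

text \<open>\<^const>\<open>Arg2pi\<close> takes values in \<open>[0, 2\<pi>)\<close> and is 0 at 0.\<close>

definition kaczmarz_step ::
  "complex mat \<Rightarrow> real Matrix.vec \<Rightarrow> nat set \<Rightarrow> complex Matrix.vec \<Rightarrow> complex Matrix.vec" where
  "kaczmarz_step A y \<Gamma> x =
     (let B = row_block A \<Gamma>;
          \<theta> = map_vec Arg2pi (B *\<^sub>v x);
          w = Matrix.vec (dim_row B)
                (\<lambda>i. complex_of_real (sqrt (subvec y \<Gamma> $ i)) * exp (\<i> * complex_of_real (\<theta> $ i)))
      in x + pinv B *\<^sub>v (w - B *\<^sub>v x))"

primrec kaczmarz ::
  "complex mat \<Rightarrow> real Matrix.vec \<Rightarrow> complex Matrix.vec \<Rightarrow> (nat \<Rightarrow> nat set) \<Rightarrow> nat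
    \<Rightarrow> complex Matrix.vec" where
  "kaczmarz A y x0 \<Gamma>s 0 = x0"
| "kaczmarz A y x0 \<Gamma>s (Suc l) = kaczmarz_step A y (\<Gamma>s l) (kaczmarz A y x0 \<Gamma>s l)"

text \<open>\<open>\<Gamma>s l \<omega>\<close> is the block drawn in iteration \<open>l\<close>.\<close>

definition iid_uniform_blocks ::
  "'w measure \<Rightarrow> nat set set \<Rightarrow> (nat \<Rightarrow> 'w \<Rightarrow> nat set) \<Rightarrow> bool" where
  "iid_uniform_blocks M T \<Gamma>s \<longleftrightarrow>
     prob_space.indep_vars M (\<lambda>_. count_space T) \<Gamma>s UNIV \<and>
     (\<forall>l. distr M (count_space T) (\<Gamma>s l) = uniform_count_measure T)"

end

(* Fix a phase and let z be the corresponding multiple of the signal. A block B = A_Gamma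
   with smallest singular value positive satisfies B B^+ = 1, so the step replaces the error
   d = x - z by its projection (1 - B^+ B) d plus the orthogonal vector B^+ (w - B z), where
   |w| = |B z| entrywise. The first term loses at least |B d|^2 / beta, and the second is at
   most 4 |y_Gamma|_1 / alpha. Averaging over the blocks of the partition turns the loss into
   |A d|^2 / (beta N_b) >= sigma_min(A)^2 |d|^2 / (beta N_b). Taking the infimum over the phase and
   using independence of the next block from the past gives a recursion E' <= q E + c whose
   fixed point is the second term of the bound. *)

theory Submission
  imports Defs
begin

text \<open>The update sees only \<open>y\<close>, so it cannot tell the phase multiples of the
  signal apart, and neither does the estimate: each entry of w - B z is at most 2 sqrt(y_i) from the
  moduli alone, which is the source of the constant 4. The phase is fixed before the block is drawn,
  so one z serves the whole average over the blocks. Singular values are given as spectra, which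
  shapes the linear algebra. A block has at most n rows, so its singular values belong to B B^* and
  control the adjoint of B rather than B itself; duality must carry beta over to B and alpha over to
  B^+. By contrast, sigma_min(A) has to bound |A d| from below on the domain of A. Both uses rest on
  the extremal property of eigenvalues. The loss is |B^+ B d|^2, at least |B d|^2 / beta because B
  maps B^+ B d to B d. With c = 4 |y|_1 / (alpha N_b) and 1 - q = sigma_min(A)^2 / (beta N_b), the
  second term of the bound is c / (1 - q), in which N_b cancels.\<close>

section \<open>The real inner product and Rayleigh quotients\<close>

text \<open>The real part of the Hermitian product is enough: every quadratic form below is real.\<close>

definition rinner :: "complex Matrix.vec \<Rightarrow> complex Matrix.vec \<Rightarrow> real" where
  "rinner v w = (\<Sum>i<dim_vec v. Re (v $ i * cnj (w $ i)))"

lemma rinner_self: "rinner v v = (l2_norm v)\<^sup>2"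
proof -
  have "(l2_norm v)\<^sup>2 = (\<Sum>i<dim_vec v. (cmod (v $ i))\<^sup>2)"
    by (simp add: l2_norm_def sum_nonneg)
  also have "\<dots> = rinner v v"
    unfolding rinner_def by (intro sum.cong refl) (simp add: cmod_power2 flip: power2_eq_square)
  finally show ?thesis by simp
qed

lemma l2_norm_nonneg [simp]: "0 \<le> l2_norm v"
  by (simp add: l2_norm_def sum_nonneg)

lemma l2_norm_sq: "(l2_norm v)\<^sup>2 = (\<Sum>i<dim_vec v. (cmod (v $ i))\<^sup>2)"
  by (simp add: l2_norm_def sum_nonneg)

lemma rinner_commute:
  assumes "v \<in> carrier_vec n" "w \<in> carrier_vec n"
  shows "rinner v w = rinner w v"
  using assms by (auto simp: rinner_def mult.commute intro!: sum.cong)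

lemma rinner_add_left:
  assumes "u \<in> carrier_vec n" "v \<in> carrier_vec n"
  shows "rinner (u + v) w = rinner u w + rinner v w"
proof -
  have "rinner (u + v) w = (\<Sum>i<n. Re (u $ i * cnj (w $ i)) + Re (v $ i * cnj (w $ i)))"
    unfolding rinner_def using assms by (intro sum.cong) (auto simp: distrib_right)
  then show ?thesis using assms by (simp add: sum.distrib rinner_def)
qed

lemma rinner_smult_left:
  "rinner (complex_of_real t \<cdot>\<^sub>v v) w = t * rinner v w"
  unfolding rinner_def sum_distrib_left by (intro sum.cong) (auto simp: algebra_simps)

lemma rinner_minus_left:
  assumes "u \<in> carrier_vec n" "v \<in> carrier_vec n"
  shows "rinner (u - v) w = rinner u w - rinner v w"
proof -
  have "u - v = u + complex_of_real (- 1) \<cdot>\<^sub>v v"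
    using assms by (intro eq_vecI) auto
  then show ?thesis
    using assms rinner_add_left[of u n "complex_of_real (- 1) \<cdot>\<^sub>v v" w] rinner_smult_left[of "- 1" v w]
    by simp
qed

lemma rinner_add_right:
  assumes "u \<in> carrier_vec n" "v \<in> carrier_vec n" "w \<in> carrier_vec n"
  shows "rinner w (u + v) = rinner w u + rinner w v"
  using assms rinner_add_left[of u n v w]
  by (simp add: rinner_commute[of w n])

lemma rinner_smult_right:
  assumes "v \<in> carrier_vec n" "w \<in> carrier_vec n"
  shows "rinner w (complex_of_real t \<cdot>\<^sub>v v) = t * rinner w v"
  using assms rinner_smult_left[of t v w] by (simp add: rinner_commute[of w n])

section \<open>Adjoints, norms and operator bounds\<close>

lemma mat_adjoint_carrier [simp, intro]:
  "A \<in> carrier_mat m n \<Longrightarrow> mat_adjoint A \<in> carrier_mat n m"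
  by (auto simp: mat_adjoint_def)

lemma dim_mat_adjoint [simp]:
  "dim_row (mat_adjoint A) = dim_col A" "dim_col (mat_adjoint A) = dim_row A"
  by (auto simp: mat_adjoint_def)

lemma index_mat_adjoint [simp]:
  fixes A :: "complex mat"
  assumes "i < dim_col A" "j < dim_row A"
  shows "mat_adjoint A $$ (i, j) = cnj (A $$ (j, i))"
  using assms by (simp add: mat_adjoint_def mat_of_rows_index)

lemma mat_adjoint_adjoint [simp]: "mat_adjoint (mat_adjoint A) = (A :: complex mat)"
  by (intro eq_matI) auto

lemma mat_adjoint_mult:
  fixes A :: "complex mat"
  assumes "A \<in> carrier_mat m n" "B \<in> carrier_mat n k"
  shows "mat_adjoint (A * B) = mat_adjoint B * mat_adjoint A"
  using assms by (intro eq_matI) (auto simp: scalar_prod_def mult.commute intro!: sum.cong)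

lemma rinner_adjoint:
  fixes A :: "complex mat"
  assumes "A \<in> carrier_mat m n" "v \<in> carrier_vec n" "w \<in> carrier_vec m"
  shows "rinner (A *\<^sub>v v) w = rinner v (mat_adjoint A *\<^sub>v w)"
proof -
  have "(\<Sum>i<m. (A *\<^sub>v v) $ i * cnj (w $ i)) = (\<Sum>i<m. \<Sum>j<n. A $$ (i, j) * v $ j * cnj (w $ i))"
    using assms by (intro sum.cong) (auto simp: scalar_prod_def sum_distrib_right atLeast0LessThan)
  also have "\<dots> = (\<Sum>j<n. \<Sum>i<m. A $$ (i, j) * v $ j * cnj (w $ i))"
    by (rule sum.swap)
  also have "\<dots> = (\<Sum>j<n. v $ j * cnj ((mat_adjoint A *\<^sub>v w) $ j))"
    using assms by (intro sum.cong)
      (auto simp: scalar_prod_def sum_distrib_left atLeast0LessThan mult_ac intro!: sum.cong)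
  finally have "Re (\<Sum>i<m. (A *\<^sub>v v) $ i * cnj (w $ i))
      = Re (\<Sum>j<n. v $ j * cnj ((mat_adjoint A *\<^sub>v w) $ j))" by (rule arg_cong)
  then show ?thesis using assms unfolding rinner_def Re_sum by simp
qed

lemma l2_norm_mult_mat_vec_sq:
  fixes A :: "complex mat"
  assumes "A \<in> carrier_mat m n" "v \<in> carrier_vec n"
  shows "(l2_norm (A *\<^sub>v v))\<^sup>2 = rinner ((mat_adjoint A * A) *\<^sub>v v) v"
proof -
  have "(l2_norm (A *\<^sub>v v))\<^sup>2 = rinner v (mat_adjoint A *\<^sub>v (A *\<^sub>v v))"
    using assms by (simp add: rinner_adjoint flip: rinner_self)
  also have "mat_adjoint A *\<^sub>v (A *\<^sub>v v) = (mat_adjoint A * A) *\<^sub>v v"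
    using assms by (metis assoc_mult_mat_vec mat_adjoint_carrier)
  also have "rinner v \<dots> = rinner \<dots> v"
    using assms by (intro rinner_commute[of _ n] mult_mat_vec_carrier[of _ n n] mult_carrier_mat[of _ n m]) auto
  finally show ?thesis .
qed

lemma l2_norm_eq_0:
  assumes "v \<in> carrier_vec n" 
  shows "l2_norm v = 0 \<longleftrightarrow> v = 0\<^sub>v n"
  using assms by (auto simp: l2_norm_def sum_nonneg_eq_0_iff)

lemma l2_norm_smult: "l2_norm (c \<cdot>\<^sub>v v) = cmod c * l2_norm v"
proof (rule power2_eq_imp_eq)
  show "(l2_norm (c \<cdot>\<^sub>v v))\<^sup>2 = (cmod c * l2_norm v)\<^sup>2"
    by (simp add: l2_norm_sq power_mult_distrib norm_mult sum_distrib_left)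
qed auto

text \<open>Along the real line v + t w the form is a quadratic polynomial in t without negative
  values, which bounds its discriminant.\<close>

lemma psd_cauchy_schwarz:
  fixes K :: "complex mat"
  assumes K: "K \<in> carrier_mat n n" and herm: "mat_adjoint K = K"
    and psd: "\<And>v. v \<in> carrier_vec n \<Longrightarrow> 0 \<le> rinner (K *\<^sub>v v) v"
    and v: "v \<in> carrier_vec n" and w: "w \<in> carrier_vec n"
  shows "(rinner (K *\<^sub>v v) w)\<^sup>2 \<le> rinner (K *\<^sub>v v) v * rinner (K *\<^sub>v w) w"
proof -
  let ?a = "rinner (K *\<^sub>v w) w" and ?b = "rinner (K *\<^sub>v v) w" and ?c = "rinner (K *\<^sub>v v) v"
  have Kv: "K *\<^sub>v v \<in> carrier_vec n" and Kw: "K *\<^sub>v w \<in> carrier_vec n"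
    using K v w by auto
  have sym: "rinner (K *\<^sub>v w) v = ?b"
    using rinner_adjoint[OF K w v] rinner_commute[OF w Kv] herm by simp
  have quad: "0 \<le> ?a * t\<^sup>2 + 2 * ?b * t + ?c" for t
  proof -
    let ?t = "complex_of_real t"
    have "0 \<le> rinner (K *\<^sub>v (v + ?t \<cdot>\<^sub>v w)) (v + ?t \<cdot>\<^sub>v w)"
      using psd v w by simp
    also have "K *\<^sub>v (v + ?t \<cdot>\<^sub>v w) = K *\<^sub>v v + ?t \<cdot>\<^sub>v (K *\<^sub>v w)"
      using K v w by (simp add: mult_add_distrib_mat_vec[OF K] mult_mat_vec)
    also have "rinner \<dots> (v + ?t \<cdot>\<^sub>v w) = ?a * t\<^sup>2 + 2 * ?b * t + ?c"
      using v w Kv Kw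
      by (simp add: rinner_add_left[of _ n] rinner_add_right[of _ n] rinner_smult_left
          rinner_smult_right[of _ n] sym power2_eq_square algebra_simps)
    finally show ?thesis .
  qed
  show ?thesis
  proof (cases "?a = 0")
    case True
    \<comment> \<open>With a = 0 the polynomial is affine, and a nonnegative affine function has
      slope zero; the witness is the point where it would equal -1.\<close>
    have "?b = 0"
    proof (rule ccontr)
      assume b: "?b \<noteq> 0"
      have "0 \<le> 2 * ?b * (- (?c + 1) / (2 * ?b)) + ?c"
        using quad[of "- (?c + 1) / (2 * ?b)"] True by simp
      also have "\<dots> = -1" using b by (simp add: field_simps)
      finally show False by simp
    qed
    then show ?thesis using True by simp
  next
    case False
    then have a: "0 < ?a" using psd[OF w] by simp
    \<comment> \<open>The minimiser t = - b / a.\<close>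
    have "0 \<le> ?a * (- ?b / ?a)\<^sup>2 + 2 * ?b * (- ?b / ?a) + ?c" by (rule quad)
    also have "\<dots> = (?c * ?a - ?b\<^sup>2) / ?a"
      using a by (simp add: field_simps power2_eq_square)
    finally show ?thesis using a by (simp add: zero_le_divide_iff)
  qed
qed

lemma mat_adjoint_one [simp]: "mat_adjoint (1\<^sub>m n :: complex mat) = 1\<^sub>m n"
  by (intro eq_matI) auto

lemma rinner_le_l2_norm:
  assumes "v \<in> carrier_vec n" "w \<in> carrier_vec n"
  shows "rinner v w \<le> l2_norm v * l2_norm w"
proof -
  have "(rinner v w)\<^sup>2 \<le> (l2_norm v * l2_norm w)\<^sup>2"
    using psd_cauchy_schwarz[of "1\<^sub>m n" n v w] assms by (simp add: rinner_self power_mult_distrib)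
  then show ?thesis by (rule power2_le_imp_le) simp
qed

text \<open>C is the Frobenius norm. It is far from sharp, but the Rayleigh argument asks only for
  some finite operator bound.\<close>

lemma l2_norm_mult_mat_vec_le:
  fixes A :: "complex mat"
  assumes A: "A \<in> carrier_mat m n"
  obtains C where "0 \<le> C" "\<And>v. v \<in> carrier_vec n \<Longrightarrow> l2_norm (A *\<^sub>v v) \<le> C * l2_norm v"
proof
  define C where "C = sqrt (\<Sum>i<m. \<Sum>j<n. (cmod (A $$ (i, j)))\<^sup>2)"
  show C0: "0 \<le> C" by (simp add: C_def sum_nonneg)
  fix v :: "complex Matrix.vec" assume v: "v \<in> carrier_vec n"
  have entry: "(cmod ((A *\<^sub>v v) $ i))\<^sup>2 \<le> (\<Sum>j<n. (cmod (A $$ (i, j)))\<^sup>2) * (l2_norm v)\<^sup>2"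
    if i: "i < m" for i
  proof -
    have "cmod ((A *\<^sub>v v) $ i) \<le> (\<Sum>j<n. cmod (A $$ (i, j)) * cmod (v $ j))"
      using A v i by (auto simp: scalar_prod_def atLeast0LessThan norm_mult
          intro!: order_trans[OF norm_sum])
    then have "(cmod ((A *\<^sub>v v) $ i))\<^sup>2 \<le> (\<Sum>j<n. cmod (A $$ (i, j)) * cmod (v $ j))\<^sup>2"
      by (intro power_mono) auto
    also have "\<dots> \<le> (\<Sum>j<n. (cmod (A $$ (i, j)))\<^sup>2) * (\<Sum>j<n. (cmod (v $ j))\<^sup>2)"
      by (rule Cauchy_Schwarz_ineq_sum)
    finally show ?thesis using v by (simp add: l2_norm_sq)
  qed
  have "(l2_norm (A *\<^sub>v v))\<^sup>2 \<le> (\<Sum>i<m. (\<Sum>j<n. (cmod (A $$ (i, j)))\<^sup>2) * (l2_norm v)\<^sup>2)"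
    unfolding l2_norm_sq[of "A *\<^sub>v v"] using A entry by (auto intro!: sum_mono)
  also have "\<dots> = (C * l2_norm v)\<^sup>2"
    by (simp add: C_def power_mult_distrib sum_nonneg flip: sum_distrib_right)
  finally show "l2_norm (A *\<^sub>v v) \<le> C * l2_norm v"
    by (rule power2_le_imp_le) (simp add: C0)
qed

lemma injective_mat_inverse:
  fixes K :: "complex mat"
  assumes K: "K \<in> carrier_mat n n"
    and inj: "\<And>v. v \<in> carrier_vec n \<Longrightarrow> K *\<^sub>v v = 0\<^sub>v n \<Longrightarrow> v = 0\<^sub>v n"
  obtains L where "L \<in> carrier_mat n n" "L * K = 1\<^sub>m n" "K * L = 1\<^sub>m n"
proof -
  have "det K \<noteq> 0" using det_0_iff_vec_prod_zero_field[OF K] inj by blast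
  from det_non_zero_imp_unit[OF K this, of "()"] show thesis
    using that unfolding Units_def by (auto simp: ring_mat_def)
qed

text \<open>Compactness of the unit sphere is not needed. Let \<open>\<mu>\<close> be the infimum of the Rayleigh
  quotient. If \<open>K = H - \<mu>\<close> were invertible, the Cauchy-Schwarz inequality for the
  semidefinite form of \<open>K\<close> would bound \<open>\<parallel>K v\<parallel>\<^sup>2\<close> by a multiple of \<open>\<langle>K v, v\<rangle>\<close>, which
  would keep the quotient away from \<open>\<mu>\<close>.\<close>

lemma rayleigh_min_eigenvalue:
  fixes H :: "complex mat"
  assumes H: "H \<in> carrier_mat n n" and herm: "mat_adjoint H = H" and n: "0 < n"
  obtains \<mu> where "complex_of_real \<mu> \<in> spectrum H"
    "\<And>v. v \<in> carrier_vec n \<Longrightarrow> \<mu> * (l2_norm v)\<^sup>2 \<le> rinner (H *\<^sub>v v) v"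
proof
  define S where "S = {rinner (H *\<^sub>v v) v | v. v \<in> carrier_vec n \<and> l2_norm v = 1}"
  define \<mu> where "\<mu> = Inf S"
  define K where "K = H - complex_of_real \<mu> \<cdot>\<^sub>m 1\<^sub>m n"
  have K: "K \<in> carrier_mat n n" using H by (auto simp: K_def)
  have Kv: "K *\<^sub>v v = H *\<^sub>v v - complex_of_real \<mu> \<cdot>\<^sub>v v" if "v \<in> carrier_vec n" for v
    unfolding K_def using H that
    by (subst minus_mult_distrib_mat_vec[of _ n n]) (auto intro!: eq_vecI)
  have rK: "rinner (K *\<^sub>v v) v = rinner (H *\<^sub>v v) v - \<mu> * (l2_norm v)\<^sup>2"
    if "v \<in> carrier_vec n" for v
    using H that by (simp add: Kv rinner_minus_left[of _ n] rinner_smult_left rinner_self)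
  obtain C where C: "0 \<le> C" "\<And>v. v \<in> carrier_vec n \<Longrightarrow> l2_norm (H *\<^sub>v v) \<le> C * l2_norm v"
    using l2_norm_mult_mat_vec_le[OF H] by blast
  have bdd: "bdd_below S"
  proof (rule bdd_belowI[of _ "- C"], unfold S_def, clarify)
    fix v :: "complex Matrix.vec" assume v: "v \<in> carrier_vec n" and v1: "l2_norm v = 1"
    have "- rinner (H *\<^sub>v v) v = rinner (- (1::real) \<cdot>\<^sub>v (H *\<^sub>v v)) v"
      using rinner_smult_left[of "-1" "H *\<^sub>v v" v] H v by simp
    also have "\<dots> \<le> l2_norm (- (1::real) \<cdot>\<^sub>v (H *\<^sub>v v)) * l2_norm v"
      using H v by (intro rinner_le_l2_norm[of _ n]) auto
    also have "\<dots> \<le> C" using C(2)[OF v] v1 by (simp add: l2_norm_smult)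
    finally show "- C \<le> rinner (H *\<^sub>v v) v" by simp
  qed
  have unit: "\<exists>u t. u \<in> carrier_vec n \<and> l2_norm u = 1 \<and> v = complex_of_real t \<cdot>\<^sub>v u \<and> l2_norm v = t"
    if v: "v \<in> carrier_vec n" and v0: "v \<noteq> 0\<^sub>v n" for v
  proof -
    have pos: "0 < l2_norm v" using l2_norm_eq_0[OF v] v0 l2_norm_nonneg[of v] by linarith
    define u where "u = complex_of_real (1 / l2_norm v) \<cdot>\<^sub>v v"
    have "l2_norm u = 1" unfolding u_def l2_norm_smult using pos by (simp add: norm_divide)
    moreover have "v = complex_of_real (l2_norm v) \<cdot>\<^sub>v u"
      using pos by (intro eq_vecI) (auto simp: u_def)
    moreover have "u \<in> carrier_vec n" using v by (simp add: u_def)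
    ultimately show ?thesis by blast
  qed
  show low: "\<mu> * (l2_norm v)\<^sup>2 \<le> rinner (H *\<^sub>v v) v" if v: "v \<in> carrier_vec n" for v
  proof (cases "v = 0\<^sub>v n")
    case True
    have "rinner (H *\<^sub>v 0\<^sub>v n) (0\<^sub>v n) = 0" using H by (simp add: rinner_def)
    moreover have "l2_norm v = 0" using True l2_norm_eq_0[OF v] by simp
    ultimately show ?thesis using True by simp
  next
    case False
    with unit[OF v] obtain u t where u: "u \<in> carrier_vec n" "l2_norm u = 1"
      "v = complex_of_real t \<cdot>\<^sub>v u" and t: "l2_norm v = t" by blast
    have "\<mu> \<le> rinner (H *\<^sub>v u) u"
      unfolding \<mu>_def using u(1,2) by (intro cInf_lower bdd) (auto simp: S_def)
    then have "\<mu> * t\<^sup>2 \<le> rinner (H *\<^sub>v u) u * t\<^sup>2" by (rule mult_right_mono) simp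
    also have "\<dots> = rinner (H *\<^sub>v v) v"
      using u(1) H unfolding u(3)
      by (simp add: mult_mat_vec rinner_smult_left rinner_smult_right[of _ n] power2_eq_square)
    finally show ?thesis by (simp add: t)
  qed
  have nonempty: "S \<noteq> {}"
  proof -
    have "unit_vec n 0 \<noteq> (0\<^sub>v n :: complex Matrix.vec)"
      using n by (metis index_unit_vec(1) index_zero_vec(1) zero_neq_one)
    from unit[OF unit_vec_carrier this] show ?thesis unfolding S_def by blast
  qed
  show "complex_of_real \<mu> \<in> spectrum H"
  proof (rule ccontr)
    assume no: "\<not> complex_of_real \<mu> \<in> spectrum H"
    have inj: "v = 0\<^sub>v n" if v: "v \<in> carrier_vec n" and 0: "K *\<^sub>v v = 0\<^sub>v n" for v
    proof (rule ccontr)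
      assume ne: "v \<noteq> 0\<^sub>v n"
      have Hv: "H *\<^sub>v v \<in> carrier_vec n" using H v by auto
      have "H *\<^sub>v v = complex_of_real \<mu> \<cdot>\<^sub>v v"
      proof (rule eq_vecI)
        fix i assume "i < dim_vec (complex_of_real \<mu> \<cdot>\<^sub>v v)"
        then have i: "i < n" using v by simp
        have "(H *\<^sub>v v - complex_of_real \<mu> \<cdot>\<^sub>v v) $ i = 0"
          using 0 Kv[OF v] i by simp
        then show "(H *\<^sub>v v) $ i = (complex_of_real \<mu> \<cdot>\<^sub>v v) $ i" using i v Hv by simp
      qed (use v Hv H in auto)
      with no ne v H show False
        unfolding spectrum_def eigenvalue_def eigenvector_def by auto
    qed
    obtain L where L: "L \<in> carrier_mat n n" "L * K = 1\<^sub>m n"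
      using injective_mat_inverse[OF K inj] by blast
    obtain c where c: "0 \<le> c" "\<And>v. v \<in> carrier_vec n \<Longrightarrow> l2_norm (L *\<^sub>v v) \<le> c * l2_norm v"
      using l2_norm_mult_mat_vec_le[OF L(1)] by blast
    obtain d where d: "0 \<le> d" "\<And>v. v \<in> carrier_vec n \<Longrightarrow> l2_norm (K *\<^sub>v v) \<le> d * l2_norm v"
      using l2_norm_mult_mat_vec_le[OF K] by blast
    have hermK: "mat_adjoint K = K"
    proof (rule eq_matI)
      fix i j assume ij: "i < dim_row K" "j < dim_col K"
      have "cnj (H $$ (j, i)) = H $$ (i, j)"
        using index_mat_adjoint[of i H j] herm H ij K by auto
      then show "mat_adjoint K $$ (i, j) = K $$ (i, j)"
        using ij K H by (auto simp: K_def)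
    qed (use K in auto)
    have psd: "0 \<le> rinner (K *\<^sub>v v) v" if "v \<in> carrier_vec n" for v
      using low[OF that] rK[OF that] by simp
    \<comment> \<open>Invertibility keeps w = K v away from zero, 1 <= c |w|, while Cauchy-Schwarz
      gives |w|^4 <= r d |w|^2. The product form postpones the division until the constants are
      known to be positive.\<close>
    have key: "1 \<le> c\<^sup>2 * d * rinner (K *\<^sub>v v) v" if v: "v \<in> carrier_vec n" and v1: "l2_norm v = 1" for v
    proof -
      let ?w = "K *\<^sub>v v" and ?r = "rinner (K *\<^sub>v v) v"
      have w: "?w \<in> carrier_vec n" using K v by auto
      have "L *\<^sub>v ?w = v"
        using L v K by (metis assoc_mult_mat_vec one_mult_mat_vec)
      then have le1: "1 \<le> c * l2_norm ?w" using c(2)[OF w] v1 by simp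
      then have "l2_norm ?w \<noteq> 0" by auto
      then have pos: "0 < l2_norm ?w" using l2_norm_nonneg[of ?w] by linarith
      have "((l2_norm ?w)\<^sup>2)\<^sup>2 = (rinner ?w ?w)\<^sup>2" by (simp add: rinner_self)
      also have "\<dots> \<le> ?r * rinner (K *\<^sub>v ?w) ?w"
        by (rule psd_cauchy_schwarz[OF K hermK psd v w])
      also have "rinner (K *\<^sub>v ?w) ?w \<le> d * (l2_norm ?w)\<^sup>2"
      proof -
        have "rinner (K *\<^sub>v ?w) ?w \<le> l2_norm (K *\<^sub>v ?w) * l2_norm ?w"
          using K w by (intro rinner_le_l2_norm[of _ n]) auto
        also have "\<dots> \<le> d * l2_norm ?w * l2_norm ?w"
          using d(2)[OF w] by (intro mult_right_mono) auto
        finally show ?thesis by (simp add: power2_eq_square)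
      qed
      finally have "((l2_norm ?w)\<^sup>2)\<^sup>2 \<le> ?r * (d * (l2_norm ?w)\<^sup>2)"
        using psd[OF v] by (simp add: mult_left_mono)
      then have "(l2_norm ?w)\<^sup>2 \<le> ?r * d"
        using pos by (simp add: power2_eq_square)
      then have "c\<^sup>2 * (l2_norm ?w)\<^sup>2 \<le> c\<^sup>2 * (?r * d)" by (rule mult_left_mono) simp
      moreover have "1 \<le> (c * l2_norm ?w)\<^sup>2" using le1 by simp
      ultimately show ?thesis by (simp add: power_mult_distrib mult_ac)
    qed
    define e where "e = 1 / (c\<^sup>2 * d)"
    \<comment> \<open>Were the product zero, \<open>key\<close> at a unit vector would read 1 <= 0;
      unit vectors exist because n > 0.\<close>
    have "c\<^sup>2 * d \<noteq> 0"
      using key nonempty unfolding S_def by fastforce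
    then have cd: "0 < c\<^sup>2 * d" using d(1) by (simp add: less_le)
    then have e: "0 < e" by (simp add: e_def)
    have "\<mu> + e \<le> Inf S"
    proof (rule cInf_greatest[OF nonempty])
      fix r assume "r \<in> S"
      then obtain v where v: "v \<in> carrier_vec n" "l2_norm v = 1" "r = rinner (H *\<^sub>v v) v"
        by (auto simp: S_def)
      have "e \<le> rinner (K *\<^sub>v v) v"
        using key[OF v(1,2)] cd by (simp add: e_def divide_le_eq mult.commute)
      then show "\<mu> + e \<le> r" using rK[OF v(1)] v(2,3) by simp
    qed
    then show False using e by (simp add: \<mu>_def)
  qed
qed

section \<open>Singular values and the pseudo-inverse\<close>

lemma rinner_smult_self: "rinner (k \<cdot>\<^sub>v v) v = Re k * (l2_norm v)\<^sup>2"
  unfolding rinner_def rinner_self[symmetric] sum_distrib_left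
  by (intro sum.cong) (auto simp: algebra_simps)

lemma gram_hermitian:
  fixes C :: "complex mat"
  assumes "C \<in> carrier_mat p r"
  shows "mat_adjoint (mat_adjoint C * C) = mat_adjoint C * C"
  using assms mat_adjoint_mult[of "mat_adjoint C" r p C r] by auto

text \<open>Elements of \<open>spectrum\<close> are complex numbers. Pairing the eigenvalue equation
  with v in \<open>rinner\<close> leaves exactly Re k, the quantity under the square root in
  \<open>singular_values\<close>.\<close>

lemma gram_eigenvalue:
  fixes C :: "complex mat"
  assumes C: "C \<in> carrier_mat p r" and k: "k \<in> spectrum (mat_adjoint C * C)"
  obtains v where "v \<in> carrier_vec r" "v \<noteq> 0\<^sub>v r" "(mat_adjoint C * C) *\<^sub>v v = k \<cdot>\<^sub>v v"
    "(l2_norm (C *\<^sub>v v))\<^sup>2 = Re k * (l2_norm v)\<^sup>2"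
proof -
  from k C obtain v where v: "v \<in> carrier_vec r" "v \<noteq> 0\<^sub>v r" "(mat_adjoint C * C) *\<^sub>v v = k \<cdot>\<^sub>v v"
    by (auto simp: spectrum_def eigenvalue_def eigenvector_def)
  then show thesis
    using that l2_norm_mult_mat_vec_sq[OF C v(1)] by (simp add: rinner_smult_self)
qed

lemma gram_eigenvalue_nonneg:
  fixes C :: "complex mat"
  assumes C: "C \<in> carrier_mat p r" and k: "k \<in> spectrum (mat_adjoint C * C)"
  shows "0 \<le> Re k"
proof -
  obtain v where v: "v \<in> carrier_vec r" "v \<noteq> 0\<^sub>v r" "(l2_norm (C *\<^sub>v v))\<^sup>2 = Re k * (l2_norm v)\<^sup>2"
    using gram_eigenvalue[OF C k] by blast
  have "0 < (l2_norm v)\<^sup>2" using v l2_norm_eq_0[OF v(1)] by simp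
  moreover have "0 \<le> Re k * (l2_norm v)\<^sup>2" by (simp flip: v(3))
  ultimately show ?thesis by (simp add: zero_le_mult_iff)
qed

text \<open>Apply the minimum version to - H and change signs.\<close>

lemma rayleigh_max_eigenvalue:
  fixes H :: "complex mat"
  assumes H: "H \<in> carrier_mat n n" and herm: "mat_adjoint H = H" and n: "0 < n"
  obtains \<mu> where "complex_of_real \<mu> \<in> spectrum H"
    "\<And>v. v \<in> carrier_vec n \<Longrightarrow> rinner (H *\<^sub>v v) v \<le> \<mu> * (l2_norm v)\<^sup>2"
proof -
  have "mat_adjoint (- H) = - H"
  proof (rule eq_matI)
    fix i j assume ij: "i < dim_row (- H)" "j < dim_col (- H)"
    then have "cnj (H $$ (j, i)) = H $$ (i, j)"
      using index_mat_adjoint[of i H j] herm H by auto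
    then show "mat_adjoint (- H) $$ (i, j) = (- H) $$ (i, j)"
      using ij H by auto
  qed (use H in auto)
  then obtain \<mu> where \<mu>: "complex_of_real \<mu> \<in> spectrum (- H)"
    and le: "\<And>v. v \<in> carrier_vec n \<Longrightarrow> \<mu> * (l2_norm v)\<^sup>2 \<le> rinner (- H *\<^sub>v v) v"
    using rayleigh_min_eigenvalue[of "- H" n] H n by auto
  have neg: "- H *\<^sub>v v = complex_of_real (- 1) \<cdot>\<^sub>v (H *\<^sub>v v)" if "v \<in> carrier_vec n" for v
    using that H by (intro eq_vecI) auto
  show thesis
  proof (rule that)
    from \<mu> H obtain v where v: "v \<in> carrier_vec n" "v \<noteq> 0\<^sub>v n"
      "- H *\<^sub>v v = complex_of_real \<mu> \<cdot>\<^sub>v v"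
      by (auto simp: spectrum_def eigenvalue_def eigenvector_def)
    have "H *\<^sub>v v = complex_of_real (- 1) \<cdot>\<^sub>v (- H *\<^sub>v v)"
      unfolding neg[OF v(1)] by (intro eq_vecI) auto
    also have "\<dots> = complex_of_real (- \<mu>) \<cdot>\<^sub>v v"
      unfolding v(3) by (intro eq_vecI) auto
    finally show "complex_of_real (- \<mu>) \<in> spectrum H"
      using v H unfolding spectrum_def eigenvalue_def eigenvector_def by auto
  next
    fix v :: "complex Matrix.vec" assume v: "v \<in> carrier_vec n"
    show "rinner (H *\<^sub>v v) v \<le> - \<mu> * (l2_norm v)\<^sup>2"
      using le[OF v] unfolding neg[OF v] rinner_smult_left by simp
  qed
qed

text \<open>The constants mu and nu of the two Rayleigh bounds are themselves eigenvalues, so their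
  square roots lie in S and compare with its extremes; the form of the Gram matrix at v is |C
  v|^2.\<close>

lemma gram_singular_value_bounds:
  fixes C :: "complex mat"
  assumes C: "C \<in> carrier_mat p r" and r: "0 < r"
  defines "S \<equiv> (\<lambda>k. sqrt (Re k)) ` spectrum (mat_adjoint C * C)"
  shows "finite S" "S \<noteq> {}" "0 \<le> Min S"
    and "v \<in> carrier_vec r \<Longrightarrow> (Min S)\<^sup>2 * (l2_norm v)\<^sup>2 \<le> (l2_norm (C *\<^sub>v v))\<^sup>2"
    and "v \<in> carrier_vec r \<Longrightarrow> (l2_norm (C *\<^sub>v v))\<^sup>2 \<le> (Max S)\<^sup>2 * (l2_norm v)\<^sup>2"
proof -
  let ?G = "mat_adjoint C * C"
  have G: "?G \<in> carrier_mat r r" using C by (intro mult_carrier_mat[of _ r p]) auto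
  show fin: "finite S" unfolding S_def using card_finite_spectrum(1)[OF G] by simp
  show ne: "S \<noteq> {}" unfolding S_def using spectrum_non_empty[OF G r] by simp
  have nonneg: "0 \<le> s" if "s \<in> S" for s
    using that gram_eigenvalue_nonneg[OF C] by (auto simp: S_def)
  show Min0: "0 \<le> Min S" using nonneg Min_in[OF fin ne] by blast
  have Max0: "0 \<le> Max S" using nonneg Max_in[OF fin ne] by blast
  assume v: "v \<in> carrier_vec r"
  obtain \<mu> where \<mu>: "complex_of_real \<mu> \<in> spectrum ?G" "\<mu> * (l2_norm v)\<^sup>2 \<le> rinner (?G *\<^sub>v v) v"
    using rayleigh_min_eigenvalue[OF G gram_hermitian[OF C] r] v by blast
  have "sqrt \<mu> \<in> S" unfolding S_def using image_eqI[OF _ \<mu>(1), of "sqrt \<mu>" "\<lambda>k. sqrt (Re k)"] by simp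
  then have "Min S \<le> sqrt \<mu>" using fin by simp
  moreover have "0 \<le> \<mu>" using gram_eigenvalue_nonneg[OF C \<mu>(1)] by simp
  ultimately have "(Min S)\<^sup>2 \<le> \<mu>" using Min0 real_le_rsqrt by (metis power_mono real_sqrt_pow2)
  then have "(Min S)\<^sup>2 * (l2_norm v)\<^sup>2 \<le> \<mu> * (l2_norm v)\<^sup>2" by (rule mult_right_mono) simp
  then show "(Min S)\<^sup>2 * (l2_norm v)\<^sup>2 \<le> (l2_norm (C *\<^sub>v v))\<^sup>2"
    using \<mu>(2) l2_norm_mult_mat_vec_sq[OF C v] by simp
  obtain \<nu> where \<nu>: "complex_of_real \<nu> \<in> spectrum ?G" "rinner (?G *\<^sub>v v) v \<le> \<nu> * (l2_norm v)\<^sup>2"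
    using rayleigh_max_eigenvalue[OF G gram_hermitian[OF C] r] v by blast
  have "sqrt \<nu> \<in> S" unfolding S_def using image_eqI[OF _ \<nu>(1), of "sqrt \<nu>" "\<lambda>k. sqrt (Re k)"] by simp
  then have "sqrt \<nu> \<le> Max S" using fin by simp
  then have "\<nu> \<le> (Max S)\<^sup>2" by (rule sqrt_le_D)
  then have "\<nu> * (l2_norm v)\<^sup>2 \<le> (Max S)\<^sup>2 * (l2_norm v)\<^sup>2" by (rule mult_right_mono) simp
  then show "(l2_norm (C *\<^sub>v v))\<^sup>2 \<le> (Max S)\<^sup>2 * (l2_norm v)\<^sup>2"
    using \<nu>(2) l2_norm_mult_mat_vec_sq[OF C v] by simp
qed

text \<open>For r <= n the set \<open>singular_values B\<close> comes from B B^*, which is the Gram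
  matrix of the adjoint; hence the bounds live on the r-dimensional side.\<close>

lemma wide_singular_value_bounds:
  fixes B :: "complex mat"
  assumes B: "B \<in> carrier_mat r n" and r: "0 < r" "r \<le> n" and v: "v \<in> carrier_vec r"
  shows "(sigma_min B)\<^sup>2 * (l2_norm v)\<^sup>2 \<le> (l2_norm (mat_adjoint B *\<^sub>v v))\<^sup>2"
    and "(l2_norm (mat_adjoint B *\<^sub>v v))\<^sup>2 \<le> (sigma_max B)\<^sup>2 * (l2_norm v)\<^sup>2"
proof -
  have "singular_values B = (\<lambda>k. sqrt (Re k)) ` spectrum (mat_adjoint (mat_adjoint B) * mat_adjoint B)"
    using B r by (simp add: singular_values_def)
  then show "(sigma_min B)\<^sup>2 * (l2_norm v)\<^sup>2 \<le> (l2_norm (mat_adjoint B *\<^sub>v v))\<^sup>2"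
    and "(l2_norm (mat_adjoint B *\<^sub>v v))\<^sup>2 \<le> (sigma_max B)\<^sup>2 * (l2_norm v)\<^sup>2"
    using gram_singular_value_bounds(4,5)[OF mat_adjoint_carrier[OF B] r(1) v]
    by (simp_all add: sigma_min_def sigma_max_def)
qed

text \<open>An operator is bounded by any bound of its adjoint: |B d|^2 is the product of d with the
  adjoint applied to B d. Cauchy-Schwarz and cancelling one factor |B d|^2 finish the
  argument.\<close>

lemma l2_norm_mult_le_adjoint:
  fixes B :: "complex mat"
  assumes B: "B \<in> carrier_mat r n" and d: "d \<in> carrier_vec n" and \<beta>: "0 \<le> \<beta>"
    and le: "\<And>v. v \<in> carrier_vec r \<Longrightarrow> (l2_norm (mat_adjoint B *\<^sub>v v))\<^sup>2 \<le> \<beta> * (l2_norm v)\<^sup>2"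
  shows "(l2_norm (B *\<^sub>v d))\<^sup>2 \<le> \<beta> * (l2_norm d)\<^sup>2"
proof (cases "l2_norm (B *\<^sub>v d) = 0")
  case True
  then show ?thesis using \<beta> by simp
next
  case False
  let ?b = "B *\<^sub>v d"
  have b: "?b \<in> carrier_vec r" using B d by auto
  have pos: "0 < (l2_norm ?b)\<^sup>2" using False by simp
  have "(l2_norm ?b)\<^sup>2 = rinner d (mat_adjoint B *\<^sub>v ?b)"
    using rinner_adjoint[OF B d b] by (simp add: rinner_self)
  also have "\<dots> \<le> l2_norm d * l2_norm (mat_adjoint B *\<^sub>v ?b)"
    using B d b by (intro rinner_le_l2_norm[of _ n] mult_mat_vec_carrier[of _ n r]) auto
  finally have "((l2_norm ?b)\<^sup>2)\<^sup>2 \<le> (l2_norm d * l2_norm (mat_adjoint B *\<^sub>v ?b))\<^sup>2"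
    by (intro power_mono) auto
  also have "\<dots> \<le> (l2_norm d)\<^sup>2 * (\<beta> * (l2_norm ?b)\<^sup>2)"
    using le[OF b] by (simp add: power_mult_distrib mult_left_mono)
  finally have "(l2_norm ?b)\<^sup>2 * (l2_norm ?b)\<^sup>2 \<le> (\<beta> * (l2_norm d)\<^sup>2) * (l2_norm ?b)\<^sup>2"
    by (simp add: power2_eq_square mult_ac)
  then show ?thesis using pos by (rule mult_right_le_imp_le)
qed

text \<open>The rank is the dimension of the span of the set of columns, so repeated columns must be
  excluded before independence of that set says anything about the kernel. Independence of n vectors
  in dimension m also gives n <= m.\<close>

lemma full_column_rank:
  fixes A :: "complex mat"
  assumes A: "A \<in> carrier_mat m n" and rank: "vec_space.rank m A = n"
  shows "\<lbrakk>v \<in> carrier_vec n; A *\<^sub>v v = 0\<^sub>v m\<rbrakk> \<Longrightarrow> v = 0\<^sub>v n"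
    and "n \<le> m"
proof -
  interpret vec_space "TYPE(complex)" m .
  have cols: "set (cols A) \<subseteq> carrier_vec m" using A cols_dim by blast
  \<comment> \<open>A maximal independent subset of the columns has n elements by the rank, so the
    set of columns cannot have fewer than n.\<close>
  have dist: "distinct (cols A)"
  proof -
    obtain S where S: "maximal S (\<lambda>T. T \<subseteq> set (cols A) \<and> lin_indpt T)"
      using maximal_exists[of "\<lambda>T. T \<subseteq> set (cols A) \<and> lin_indpt T" "card (set (cols A))" "{}"]
      by (meson List.finite_set card_mono empty_iff empty_subsetI finite_lin_indpt2 rev_finite_subset)
    then have "card S \<le> card (set (cols A))" by (simp add: card_mono maximal_def)
    moreover have "card S = length (cols A)"
      using rank_card_indpt[OF A S] rank A by simp
    ultimately show ?thesis
      using card_length[of "cols A"] by (intro card_distinct) linarith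
  qed
  have indpt: "lin_indpt (set (cols A))" using full_rank_lin_indpt[OF A rank dist] .
  show "\<lbrakk>v \<in> carrier_vec n; A *\<^sub>v v = 0\<^sub>v m\<rbrakk> \<Longrightarrow> v = 0\<^sub>v n"
    using lin_depI[OF A _ _ _ dist] indpt by blast
  have "card (set (cols A)) \<le> dim" using li_le_dim(2)[OF fin_dim] cols indpt by simp
  then show "n \<le> m"
    using A dist distinct_card[OF dist] dim_is_n by simp
qed

text \<open>For square \<open>A\<close> the set \<^const>\<open>singular_values\<close> is read off from \<open>A A\<^sup>*\<close>, not from
  \<open>A\<^sup>* A\<close>, so this case needs a transfer of eigenvalues along \<open>v \<mapsto> A v\<close>.\<close>

lemma tall_sigma_min:
  fixes A :: "complex mat"
  assumes A: "A \<in> carrier_mat m n" and n: "0 < n" "n \<le> m"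
    and inj: "\<And>v. v \<in> carrier_vec n \<Longrightarrow> A *\<^sub>v v = 0\<^sub>v m \<Longrightarrow> v = 0\<^sub>v n"
  shows "0 < sigma_min A"
    and "v \<in> carrier_vec n \<Longrightarrow> (sigma_min A)\<^sup>2 * (l2_norm v)\<^sup>2 \<le> (l2_norm (A *\<^sub>v v))\<^sup>2"
proof -
  let ?G = "mat_adjoint A * A"
  let ?S = "(\<lambda>k. sqrt (Re k)) ` spectrum ?G"
  have G: "?G \<in> carrier_mat n n" using A by (intro mult_carrier_mat[of _ n m]) auto
  have pos: "0 < Re k" if k: "k \<in> spectrum ?G" for k
  proof -
    obtain u where u: "u \<in> carrier_vec n" "u \<noteq> 0\<^sub>v n" "(l2_norm (A *\<^sub>v u))\<^sup>2 = Re k * (l2_norm u)\<^sup>2"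
      using gram_eigenvalue[OF A k] by blast
    have "A *\<^sub>v u \<in> carrier_vec m" using A u by auto
    then have "l2_norm (A *\<^sub>v u) \<noteq> 0" using inj[OF u(1)] u(2) l2_norm_eq_0 by blast
    then have "Re k \<noteq> 0" using u(3) by auto
    then show ?thesis using gram_eigenvalue_nonneg[OF A k] by simp
  qed
  note gram = gram_singular_value_bounds[OF A n(1)]
  have Min_pos: "0 < Min ?S"
    using Min_in[OF gram(1,2)] pos by auto
  have sub: "spectrum ?G \<subseteq> spectrum (A * mat_adjoint A)" if "m = n"
  proof
    fix k assume k: "k \<in> spectrum ?G"
    obtain u where u: "u \<in> carrier_vec n" "u \<noteq> 0\<^sub>v n" "?G *\<^sub>v u = k \<cdot>\<^sub>v u"
      using gram_eigenvalue[OF A k] by blast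
    have Au: "A *\<^sub>v u \<in> carrier_vec m" using A u by auto
    have "(A * mat_adjoint A) *\<^sub>v (A *\<^sub>v u) = A *\<^sub>v (mat_adjoint A *\<^sub>v (A *\<^sub>v u))"
      using A Au by (intro assoc_mult_mat_vec[of _ m n _ m]) auto
    also have "mat_adjoint A *\<^sub>v (A *\<^sub>v u) = ?G *\<^sub>v u"
      using A u by (intro assoc_mult_mat_vec[of _ n m _ n, symmetric]) auto
    also have "A *\<^sub>v (?G *\<^sub>v u) = k \<cdot>\<^sub>v (A *\<^sub>v u)"
      unfolding u(3) using A u by (simp add: mult_mat_vec)
    finally have "(A * mat_adjoint A) *\<^sub>v (A *\<^sub>v u) = k \<cdot>\<^sub>v (A *\<^sub>v u)" .
    moreover have "A *\<^sub>v u \<noteq> 0\<^sub>v m" using inj[OF u(1)] u(2) by blast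
    ultimately show "k \<in> spectrum (A * mat_adjoint A)"
      using A Au unfolding spectrum_def eigenvalue_def eigenvector_def by auto
  qed
  have "0 < sigma_min A \<and> sigma_min A \<le> Min ?S"
  proof (cases "m = n")
    case False
    then have "singular_values A = ?S" using A n by (simp add: singular_values_def)
    then show ?thesis using Min_pos by (simp add: sigma_min_def)
  next
    case True
    let ?S' = "(\<lambda>k. sqrt (Re k)) ` spectrum (A * mat_adjoint A)"
    have sv: "singular_values A = ?S'" using A True by (simp add: singular_values_def)
    have A': "mat_adjoint A \<in> carrier_mat n m" using A by auto
    have gram': "finite ?S'" "?S' \<noteq> {}"
      using gram_singular_value_bounds(1,2)[OF A'] n by simp_all
    obtain L where L: "L \<in> carrier_mat n n" "A * L = 1\<^sub>m n"
      using injective_mat_inverse[of A n] A True inj by metis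
    \<comment> \<open>A square injective A is onto, so u = A (L u); a vector u killed by the adjoint
      of A is then orthogonal to itself.\<close>
    have pos': "0 < Re k" if k: "k \<in> spectrum (A * mat_adjoint A)" for k
    proof (rule ccontr)
      assume "\<not> 0 < Re k"
      then have "Re k = 0" using gram_eigenvalue_nonneg[OF A', of k] k by simp
      then obtain u where u: "u \<in> carrier_vec m" "u \<noteq> 0\<^sub>v m" "l2_norm (mat_adjoint A *\<^sub>v u) = 0"
        using gram_eigenvalue[OF A', of k] k by auto
      have 0: "mat_adjoint A *\<^sub>v u = 0\<^sub>v n"
        using u(3) l2_norm_eq_0[of "mat_adjoint A *\<^sub>v u" n] A' u(1) by auto
      have "A *\<^sub>v (L *\<^sub>v u) = u"
        using A L u True by (metis assoc_mult_mat_vec one_mult_mat_vec)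
      then have "(l2_norm u)\<^sup>2 = rinner (A *\<^sub>v (L *\<^sub>v u)) u" by (simp add: rinner_self)
      also have "\<dots> = rinner (L *\<^sub>v u) (0\<^sub>v n)"
        using rinner_adjoint[OF A, of "L *\<^sub>v u" u] 0 L u True by auto
      also have "\<dots> = 0" using L by (simp add: rinner_def)
      finally show False using u l2_norm_eq_0 by auto
    qed
    have "0 < Min ?S'" using Min_in[OF gram'] pos' by auto
    moreover have "Min ?S' \<le> Min ?S"
      using sub[OF True] gram(2) gram'(1) by (intro Min_antimono) auto
    ultimately show ?thesis by (simp add: sigma_min_def sv)
  qed
  then have pos_le: "0 < sigma_min A" "sigma_min A \<le> Min ?S" by auto
  show "0 < sigma_min A" by fact
  assume v: "v \<in> carrier_vec n"
  have "(sigma_min A)\<^sup>2 \<le> (Min ?S)\<^sup>2" using pos_le by (intro power_mono) auto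
  then have "(sigma_min A)\<^sup>2 * (l2_norm v)\<^sup>2 \<le> (Min ?S)\<^sup>2 * (l2_norm v)\<^sup>2"
    by (rule mult_right_mono) simp
  also have "\<dots> \<le> (l2_norm (A *\<^sub>v v))\<^sup>2" by (rule gram(4)[OF v])
  finally show "(sigma_min A)\<^sup>2 * (l2_norm v)\<^sup>2 \<le> (l2_norm (A *\<^sub>v v))\<^sup>2" .
qed

text \<open>The witness is \<open>mat_adjoint B * L\<close> with L the inverse of
  \<open>B * mat_adjoint B\<close>. As \<open>pinv\<close> is a definite description, its properties
  become available only after uniqueness is shown too.\<close>

lemma pinv_full_row_rank:
  fixes B :: "complex mat"
  assumes B: "B \<in> carrier_mat r n"
    and inj: "\<And>v. v \<in> carrier_vec r \<Longrightarrow> mat_adjoint B *\<^sub>v v = 0\<^sub>v n \<Longrightarrow> v = 0\<^sub>v r"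
  shows "pinv B \<in> carrier_mat n r" "B * pinv B = 1\<^sub>m r"
    "mat_adjoint (pinv B * B) = pinv B * B"
proof -
  let ?B' = "mat_adjoint B" and ?G = "B * mat_adjoint B"
  have B': "?B' \<in> carrier_mat n r" using B by auto
  have G: "?G \<in> carrier_mat r r" using B B' by (rule mult_carrier_mat)
  have "v = 0\<^sub>v r" if v: "v \<in> carrier_vec r" and 0: "?G *\<^sub>v v = 0\<^sub>v r" for v
  proof -
    have "(l2_norm (?B' *\<^sub>v v))\<^sup>2 = rinner (?G *\<^sub>v v) v"
      using l2_norm_mult_mat_vec_sq[OF B' v] by simp
    also have "\<dots> = 0" unfolding 0 by (simp add: rinner_def)
    finally have "?B' *\<^sub>v v = 0\<^sub>v n" using l2_norm_eq_0[of "?B' *\<^sub>v v" n] B' v by auto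
    then show ?thesis using inj[OF v] by simp
  qed
  then obtain L where L: "L \<in> carrier_mat r r" "L * ?G = 1\<^sub>m r" "?G * L = 1\<^sub>m r"
    using injective_mat_inverse[OF G] by blast
  \<comment> \<open>The inverse of a Hermitian matrix is Hermitian; this is what makes X B Hermitian
    below.\<close>
  have Lherm: "mat_adjoint L = L"
  proof -
    have L': "mat_adjoint L \<in> carrier_mat r r" using L by auto
    have "mat_adjoint L * ?G = mat_adjoint (?G * L)"
      using mat_adjoint_mult[OF G L(1)] mat_adjoint_mult[OF B B'] by simp
    then have "mat_adjoint L * ?G = 1\<^sub>m r" using L(3) by simp
    then have "mat_adjoint L * (?G * L) = L"
      using assoc_mult_mat[OF L' G L(1)] L(1) by simp
    then show ?thesis unfolding L(3) right_mult_one_mat[OF L'] .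
  qed
  define X where "X = ?B' * L"
  have X: "X \<in> carrier_mat n r" unfolding X_def using B' L(1) by (rule mult_carrier_mat)
  have BX: "B * X = 1\<^sub>m r"
    unfolding X_def using assoc_mult_mat[OF B B' L(1)] L(3) by simp
  have XB: "mat_adjoint (X * B) = X * B"
  proof -
    have "mat_adjoint (X * B) = ?B' * (L * B)"
      using mat_adjoint_mult[OF X B] mat_adjoint_mult[OF B' L(1)] Lherm by (simp add: X_def)
    then show ?thesis unfolding X_def using assoc_mult_mat[OF B' L(1) B] by simp
  qed
  have pinvX: "is_pinv B X"
    unfolding is_pinv_def using B X BX XB assoc_mult_mat[OF X B X] by simp
  \<comment> \<open>X B and Y B are Hermitian with (X B) (Y B) = X B and (Y B) (X B) = Y B. The
    adjoint of the first equation identifies them, and then Y = (Y B) Y = (X B) Y = X (B Y) =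
    X.\<close>
  have unique: "Y = X" if Y: "is_pinv B Y" for Y
  proof -
    have Yc: "Y \<in> carrier_mat n r" and BYB: "B * Y * B = B" and YBY: "Y * B * Y = Y"
      and YB: "mat_adjoint (Y * B) = Y * B"
      using Y B by (auto simp: is_pinv_def)
    have BY: "B * Y = 1\<^sub>m r"
    proof -
      have BYc: "B * Y \<in> carrier_mat r r" using B Yc by (rule mult_carrier_mat)
      have "B * Y = (B * Y) * (B * X)" unfolding BX right_mult_one_mat[OF BYc] ..
      also have "\<dots> = (B * Y * B) * X" using assoc_mult_mat[OF BYc B X] by simp
      finally show ?thesis using BYB BX by simp
    qed
    have XBc: "X * B \<in> carrier_mat n n" and YBc: "Y * B \<in> carrier_mat n n"
      using X Yc B by (auto intro: mult_carrier_mat)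
    have "(X * B) * (Y * B) = X * B"
      using assoc_mult_mat[OF X B YBc] assoc_mult_mat[OF B Yc B] BYB by simp
    then have "mat_adjoint ((X * B) * (Y * B)) = X * B" using XB by simp
    then have "(Y * B) * (X * B) = X * B"
      using mat_adjoint_mult[OF XBc YBc] XB YB by simp
    moreover have "(Y * B) * (X * B) = Y * B"
      using assoc_mult_mat[OF Yc B XBc] assoc_mult_mat[OF B X B] BX B by simp
    ultimately have eq: "X * B = Y * B" by simp
    have "Y = (X * B) * Y" using YBY eq by simp
    also have "\<dots> = X" using assoc_mult_mat[OF X B Yc] BY X by simp
    finally show ?thesis .
  qed
  have "pinv B = X" unfolding pinv_def by (rule the_equality[where P = "is_pinv B", OF pinvX unique])
  then show "pinv B \<in> carrier_mat n r" "B * pinv B = 1\<^sub>m r"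
    "mat_adjoint (pinv B * B) = pinv B * B"
    using X BX XB by simp_all
qed

text \<open>The hypothesis concerns the adjoint of B, so q = X u must be put into its range. The
  choice v = \<open>mat_adjoint X *\<^sub>v q\<close> does it: the adjoint of B sends v to X B q =
  q, and |q|^2 is the product of u and v.\<close>

lemma right_inverse_norm_le:
  fixes B :: "complex mat"
  assumes B: "B \<in> carrier_mat r n" and X: "X \<in> carrier_mat n r"
    and BX: "B * X = 1\<^sub>m r" and XB: "mat_adjoint (X * B) = X * B"
    and \<alpha>: "0 < \<alpha>" and lower: "\<And>v. v \<in> carrier_vec r \<Longrightarrow> \<alpha> * (l2_norm v)\<^sup>2 \<le> (l2_norm (mat_adjoint B *\<^sub>v v))\<^sup>2"
    and u: "u \<in> carrier_vec r"
  shows "\<alpha> * (l2_norm (X *\<^sub>v u))\<^sup>2 \<le> (l2_norm u)\<^sup>2"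
proof -
  let ?q = "X *\<^sub>v u"
  have q: "?q \<in> carrier_vec n" using X u by auto
  define v where "v = mat_adjoint X *\<^sub>v ?q"
  have X': "mat_adjoint X \<in> carrier_mat r n" using X by auto
  have v: "v \<in> carrier_vec r" using X' q by (simp add: v_def)
  have Bq: "B *\<^sub>v ?q = u" using assoc_mult_mat_vec[OF B X u] BX u by simp
  have "mat_adjoint B *\<^sub>v v = mat_adjoint (X * B) *\<^sub>v ?q"
    unfolding v_def mat_adjoint_mult[OF X B]
    using assoc_mult_mat_vec[OF mat_adjoint_carrier[OF B] X' q] by simp
  also have "\<dots> = ?q" using XB assoc_mult_mat_vec[OF X B q] Bq by simp
  finally have B'v: "mat_adjoint B *\<^sub>v v = ?q" .
  have "(l2_norm ?q)\<^sup>2 = rinner u v"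
    using rinner_adjoint[OF B q v] Bq B'v by (simp add: rinner_self)
  also have "\<dots> \<le> l2_norm u * l2_norm v" using u v by (rule rinner_le_l2_norm)
  finally have "((l2_norm ?q)\<^sup>2)\<^sup>2 \<le> (l2_norm u * l2_norm v)\<^sup>2" by (intro power_mono) auto
  then have "\<alpha> * ((l2_norm ?q)\<^sup>2)\<^sup>2 \<le> \<alpha> * (l2_norm u * l2_norm v)\<^sup>2"
    using \<alpha> by (simp add: mult_left_mono)
  also have "\<dots> = (l2_norm u)\<^sup>2 * (\<alpha> * (l2_norm v)\<^sup>2)" by (simp add: power_mult_distrib)
  also have "\<dots> \<le> (l2_norm u)\<^sup>2 * (l2_norm ?q)\<^sup>2"
    using lower[OF v] B'v by (intro mult_left_mono) auto
  finally have *: "(\<alpha> * (l2_norm ?q)\<^sup>2) * (l2_norm ?q)\<^sup>2 \<le> (l2_norm u)\<^sup>2 * (l2_norm ?q)\<^sup>2"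
    by (simp add: power2_eq_square mult_ac)
  show ?thesis
  proof (cases "l2_norm ?q = 0")
    case False
    then show ?thesis using * by (intro mult_right_le_imp_le[OF *]) simp
  qed simp
qed

text \<open>\<open>X B\<close> is the orthogonal projection onto the range of \<open>X\<close>, so the new error splits
  orthogonally into \<open>(1 - X B) (x - z)\<close> and \<open>X (w - B z)\<close>.\<close>

lemma block_step_norm_le:
  fixes B :: "complex mat"
  assumes B: "B \<in> carrier_mat r n" and X: "X \<in> carrier_mat n r"
    and BX: "B * X = 1\<^sub>m r" and XB: "mat_adjoint (X * B) = X * B"
    and \<alpha>: "0 < \<alpha>" and \<beta>: "0 < \<beta>"
    and lower: "\<And>v. v \<in> carrier_vec r \<Longrightarrow> \<alpha> * (l2_norm v)\<^sup>2 \<le> (l2_norm (mat_adjoint B *\<^sub>v v))\<^sup>2"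
    and upper: "\<And>v. v \<in> carrier_vec r \<Longrightarrow> (l2_norm (mat_adjoint B *\<^sub>v v))\<^sup>2 \<le> \<beta> * (l2_norm v)\<^sup>2"
    and x: "x \<in> carrier_vec n" and z: "z \<in> carrier_vec n" and w: "w \<in> carrier_vec r"
  shows "(l2_norm (x + X *\<^sub>v (w - B *\<^sub>v x) - z))\<^sup>2
    \<le> (l2_norm (x - z))\<^sup>2 - (l2_norm (B *\<^sub>v (x - z)))\<^sup>2 / \<beta> + (l2_norm (w - B *\<^sub>v z))\<^sup>2 / \<alpha>"
proof -
  define d where "d = x - z"
  define e where "e = w - B *\<^sub>v z"
  define p where "p = X *\<^sub>v (B *\<^sub>v d)"
  define q where "q = X *\<^sub>v e"
  define P where "P = X * B"
  have P: "P \<in> carrier_mat n n" unfolding P_def using X B by (rule mult_carrier_mat)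
  have dc: "d \<in> carrier_vec n" and ec: "e \<in> carrier_vec r" and Bd: "B *\<^sub>v d \<in> carrier_vec r"
    using x z w B by (auto simp: d_def e_def)
  have pc: "p \<in> carrier_vec n" and qc: "q \<in> carrier_vec n"
    using X Bd ec by (auto simp: p_def q_def)
  have Pd: "P *\<^sub>v d = p" unfolding P_def p_def using assoc_mult_mat_vec[OF X B dc] .
  have PX: "P *\<^sub>v (X *\<^sub>v u) = X *\<^sub>v u" if u: "u \<in> carrier_vec r" for u
  proof -
    have Xu: "X *\<^sub>v u \<in> carrier_vec n" using X u by auto
    have "B *\<^sub>v (X *\<^sub>v u) = u" using assoc_mult_mat_vec[OF B X u] BX u by simp
    then show ?thesis unfolding P_def using assoc_mult_mat_vec[OF X B Xu] by simp
  qed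
  have Pp: "P *\<^sub>v p = p" and Pq: "P *\<^sub>v q = q" using PX Bd ec by (simp_all add: p_def q_def)
  \<comment> \<open>P is self-adjoint, so it can be moved from d to any u that it fixes; p and q are
    fixed, being in the range of X.\<close>
  have proj: "rinner p u = rinner d u" if u: "u \<in> carrier_vec n" and "P *\<^sub>v u = u" for u
    using rinner_adjoint[OF P dc u] that XB Pd by (simp add: P_def)
  have dp: "rinner d p = rinner p p" and dq: "rinner d q = rinner p q"
    using proj[OF pc Pp] proj[OF qc Pq] by simp_all
  have "w - B *\<^sub>v x = e - B *\<^sub>v d"
    unfolding e_def d_def using w B x z by (auto simp: mult_minus_distrib_mat_vec intro!: eq_vecI)
  then have "X *\<^sub>v (w - B *\<^sub>v x) = q - p"
    unfolding p_def q_def using mult_minus_distrib_mat_vec[OF X ec Bd] by simp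
  then have "x + X *\<^sub>v (w - B *\<^sub>v x) - z = (d - p) + q"
    unfolding d_def using x z pc qc by (intro eq_vecI) auto
  then have "(l2_norm (x + X *\<^sub>v (w - B *\<^sub>v x) - z))\<^sup>2 = rinner ((d - p) + q) ((d - p) + q)"
    by (simp add: rinner_self)
  also have "\<dots> = rinner d d - rinner p p + rinner q q"
  proof -
    have m: "d - p \<in> carrier_vec n" using dc pc by auto
    have "rinner (d - p) q = 0" using rinner_minus_left[OF dc pc, of q] dq by simp
    moreover have "rinner (d - p) (d - p) = rinner d d - rinner p p"
      using rinner_minus_left[OF dc pc, of "d - p"] rinner_minus_left[OF dc pc, of d]
        rinner_minus_left[OF dc pc, of p] rinner_commute[OF dc m] rinner_commute[OF pc m]
        rinner_commute[OF dc pc] dp by simp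
    ultimately show ?thesis
      using rinner_add_left[OF m qc, of "(d - p) + q"] rinner_add_right[OF m qc m]
        rinner_add_right[OF m qc qc] rinner_commute[OF m qc] by simp
  qed
  also have "\<dots> = (l2_norm d)\<^sup>2 - (l2_norm p)\<^sup>2 + (l2_norm q)\<^sup>2" by (simp add: rinner_self)
  also have "\<dots> \<le> (l2_norm d)\<^sup>2 - (l2_norm (B *\<^sub>v d))\<^sup>2 / \<beta> + (l2_norm e)\<^sup>2 / \<alpha>"
  proof -
    \<comment> \<open>Since B X = 1, projecting d does not change its image under B, so the bound by
      beta applied to p turns |p|^2 into |B d|^2.\<close>
    have "B *\<^sub>v p = B *\<^sub>v d"
      using assoc_mult_mat_vec[OF B X Bd] BX Bd by (simp add: p_def)
    then have "(l2_norm (B *\<^sub>v d))\<^sup>2 \<le> \<beta> * (l2_norm p)\<^sup>2"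
      using l2_norm_mult_le_adjoint[OF B pc _ upper] \<beta> by simp
    moreover have "\<alpha> * (l2_norm q)\<^sup>2 \<le> (l2_norm e)\<^sup>2"
      unfolding q_def by (rule right_inverse_norm_le[OF B X BX XB \<alpha> lower ec])
    ultimately show ?thesis using \<alpha> \<beta> by (simp add: field_simps add_mono diff_mono)
  qed
  finally show ?thesis by (simp add: d_def e_def)
qed

section \<open>One block step\<close>

lemma bij_betw_pick:
  assumes "finite \<Gamma>"
  shows "bij_betw (pick \<Gamma>) {..<card \<Gamma>} \<Gamma>"
proof -
  have inj: "inj_on (pick \<Gamma>) {..<card \<Gamma>}"
  proof (rule linorder_inj_onI')
    fix i j assume "i \<in> {..<card \<Gamma>}" "j \<in> {..<card \<Gamma>}" "i < j"
    then show "pick \<Gamma> i \<noteq> pick \<Gamma> j" using pick_mono_le[of j \<Gamma> i] by simp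
  qed
  moreover have "pick \<Gamma> ` {..<card \<Gamma>} = \<Gamma>"
  proof (rule card_subset_eq[OF assms])
    show "pick \<Gamma> ` {..<card \<Gamma>} \<subseteq> \<Gamma>" using pick_in_set_le by auto
    show "card (pick \<Gamma> ` {..<card \<Gamma>}) = card \<Gamma>" using card_image[OF inj] by simp
  qed
  ultimately show ?thesis by (simp add: bij_betw_def)
qed

lemma sum_pick:
  assumes "finite \<Gamma>"
  shows "(\<Sum>i<card \<Gamma>. f (pick \<Gamma> i)) = (\<Sum>i\<in>\<Gamma>. f i)"
  using sum.reindex_bij_betw[OF bij_betw_pick[OF assms]] .

lemma row_block_carrier:
  assumes "A \<in> carrier_mat m n" "\<Gamma> \<subseteq> {0..<m}"
  shows "row_block A \<Gamma> \<in> carrier_mat (card \<Gamma>) n"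
proof -
  have "{i. i < m \<and> i \<in> \<Gamma>} = \<Gamma>" using assms(2) by auto
  then show ?thesis using assms(1) by (intro carrier_matI) (simp_all add: row_block_def dim_submatrix)
qed

lemma row_block_mult_index:
  assumes A: "A \<in> carrier_mat m n" and \<Gamma>: "\<Gamma> \<subseteq> {0..<m}" and i: "i < card \<Gamma>"
  shows "(row_block A \<Gamma> *\<^sub>v v) $ i = (A *\<^sub>v v) $ pick \<Gamma> i"
proof -
  have set: "{i. i < dim_row A \<and> i \<in> \<Gamma>} = \<Gamma>" using A \<Gamma> by auto
  have pick: "pick \<Gamma> i < m" using pick_in_set_le[OF i] \<Gamma> by auto
  have "row (row_block A \<Gamma>) i = row A (pick \<Gamma> i)"
  proof (rule eq_vecI)
    fix j assume "j < dim_vec (row A (pick \<Gamma> i))"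
    then have j: "j < n" using A by simp
    have "row_block A \<Gamma> $$ (i, j) = A $$ (pick \<Gamma> i, pick UNIV j)"
      unfolding row_block_def using A i j set by (intro submatrix_index) auto
    then show "row (row_block A \<Gamma>) i $ j = row A (pick \<Gamma> i) $ j"
      using row_block_carrier[OF A \<Gamma>] A i j pick by (simp add: pick_UNIV)
  qed (use row_block_carrier[OF A \<Gamma>] A in auto)
  then show ?thesis using row_block_carrier[OF A \<Gamma>] A i pick by simp
qed

lemma l2_norm_row_block_mult:
  assumes A: "A \<in> carrier_mat m n" and \<Gamma>: "\<Gamma> \<subseteq> {0..<m}"
  shows "(l2_norm (row_block A \<Gamma> *\<^sub>v v))\<^sup>2 = (\<Sum>i\<in>\<Gamma>. (cmod ((A *\<^sub>v v) $ i))\<^sup>2)"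
proof -
  have "finite \<Gamma>" using \<Gamma> finite_subset by blast
  have "(l2_norm (row_block A \<Gamma> *\<^sub>v v))\<^sup>2 = (\<Sum>i<card \<Gamma>. (cmod ((A *\<^sub>v v) $ pick \<Gamma> i))\<^sup>2)"
    unfolding l2_norm_sq using row_block_carrier[OF A \<Gamma>] row_block_mult_index[OF A \<Gamma>]
    by (intro sum.cong) auto
  then show ?thesis
    using sum_pick[OF \<open>finite \<Gamma>\<close>, of "\<lambda>i. (cmod ((A *\<^sub>v v) $ i))\<^sup>2"] by simp
qed

lemma sum_partition_on:
  assumes "partition_on S T" "finite S"
  shows "(\<Sum>\<Gamma>\<in>T. \<Sum>i\<in>\<Gamma>. f i) = (\<Sum>i\<in>S. f i)"
proof -
  have "(\<Sum>i\<in>\<Union> T. f i) = (\<Sum>\<Gamma>\<in>T. \<Sum>i\<in>\<Gamma>. f i)"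
    using assms finite_subset[of _ S]
    by (subst sum.Union_disjoint) (auto simp: partition_on_def disjoint_def)
  then show ?thesis using partition_onD1[OF assms(1)] by simp
qed

lemma kaczmarz_step_carrier:
  assumes "A \<in> carrier_mat m n" "\<Gamma> \<subseteq> {0..<m}" "x \<in> carrier_vec n"
    and "pinv (row_block A \<Gamma>) \<in> carrier_mat n (card \<Gamma>)"
  shows "kaczmarz_step A y \<Gamma> x \<in> carrier_vec n"
  using assms row_block_carrier[OF assms(1,2)]
  by (auto simp: kaczmarz_step_def Let_def intro!: add_carrier_vec mult_mat_vec_carrier[of _ n "card \<Gamma>"])

lemma phase_dist_le:
  assumes "\<theta> \<in> {0..<2 * pi}"
  shows "phase_dist x v \<le> l2_norm (x - exp (\<i> * complex_of_real \<theta>) \<cdot>\<^sub>v v)"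
  unfolding phase_dist_def by (intro cINF_lower assms bdd_belowI2[where m = 0]) simp

lemma phase_dist_nonneg: "0 \<le> phase_dist x v"
  unfolding phase_dist_def using pi_gt_zero by (intro cINF_greatest) auto

text \<open>The deterministic setting. Nonemptiness of T, which gives n > 0, Nb > 0 and beta > 0, is
  no hypothesis of the theorem; there it follows from the existence of a draw.\<close>

locale phase_retrieval_paving =
  fixes A :: "complex mat" and m n Nb :: nat and \<alpha> \<beta> :: real
    and y :: "real Matrix.vec" and xhat :: "complex Matrix.vec" and T :: "nat set set"
  assumes A: "A \<in> carrier_mat m n"
    and rank: "vec_space.rank m A = n"
    and xhat: "xhat \<in> carrier_vec n"
    and y: "y = map_vec (\<lambda>z. (cmod z)\<^sup>2) (A *\<^sub>v xhat)"
    and paving: "row_paving A Nb \<alpha> \<beta> T"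
    and \<alpha>: "\<alpha> > 0"
    and card_le: "\<Gamma> \<in> T \<Longrightarrow> card \<Gamma> \<le> n"
    and T_nonempty: "T \<noteq> {}"
begin

lemma part: "partition_on {0..<m} T" and card_T: "card T = Nb"
  using paving A by (auto simp: row_paving_def)

lemma finite_T: "finite T"
  by (rule finite_elements[OF _ part]) simp

lemma block_subset: "\<Gamma> \<in> T \<Longrightarrow> \<Gamma> \<subseteq> {0..<m}"
  using partition_onD1[OF part] by auto

lemma block_card_pos: "\<Gamma> \<in> T \<Longrightarrow> 0 < card \<Gamma>"
  using partition_onD3[OF part] block_subset finite_subset[of \<Gamma> "{0..<m}"] by (auto simp: card_gt_0_iff)

lemma Nb_pos: "0 < Nb"
  using card_T finite_T T_nonempty by (auto simp: card_gt_0_iff)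

lemma n_pos: "0 < n"
  using T_nonempty block_card_pos card_le by fastforce

lemma \<beta>: "\<beta> > 0"
  using T_nonempty paving \<alpha> by (fastforce simp: row_paving_def)

lemma block_bounds:
  assumes \<Gamma>: "\<Gamma> \<in> T" and v: "v \<in> carrier_vec (card \<Gamma>)"
  defines "B \<equiv> row_block A \<Gamma>"
  shows "\<alpha> * (l2_norm v)\<^sup>2 \<le> (l2_norm (mat_adjoint B *\<^sub>v v))\<^sup>2"
    and "(l2_norm (mat_adjoint B *\<^sub>v v))\<^sup>2 \<le> \<beta> * (l2_norm v)\<^sup>2"
proof -
  have B: "B \<in> carrier_mat (card \<Gamma>) n"
    unfolding B_def using row_block_carrier[OF A block_subset[OF \<Gamma>]] .
  note bounds = wide_singular_value_bounds[OF B block_card_pos[OF \<Gamma>] card_le[OF \<Gamma>] v]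
  have "\<alpha> \<le> (sigma_min B)\<^sup>2" "(sigma_max B)\<^sup>2 \<le> \<beta>"
    using paving \<Gamma> by (auto simp: row_paving_def B_def)
  then have "\<alpha> * (l2_norm v)\<^sup>2 \<le> (sigma_min B)\<^sup>2 * (l2_norm v)\<^sup>2"
    "(sigma_max B)\<^sup>2 * (l2_norm v)\<^sup>2 \<le> \<beta> * (l2_norm v)\<^sup>2"
    by (simp_all add: mult_right_mono)
  then show "\<alpha> * (l2_norm v)\<^sup>2 \<le> (l2_norm (mat_adjoint B *\<^sub>v v))\<^sup>2"
    and "(l2_norm (mat_adjoint B *\<^sub>v v))\<^sup>2 \<le> \<beta> * (l2_norm v)\<^sup>2"
    using bounds by linarith+
qed

text \<open>Positivity of alpha makes the adjoint of the block injective, so the block has full row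
  rank.\<close>

lemma block_pinv:
  assumes \<Gamma>: "\<Gamma> \<in> T"
  defines "B \<equiv> row_block A \<Gamma>"
  shows "pinv B \<in> carrier_mat n (card \<Gamma>)" "B * pinv B = 1\<^sub>m (card \<Gamma>)"
    "mat_adjoint (pinv B * B) = pinv B * B"
proof -
  have B: "B \<in> carrier_mat (card \<Gamma>) n"
    unfolding B_def using row_block_carrier[OF A block_subset[OF \<Gamma>]] .
  have "v = 0\<^sub>v (card \<Gamma>)"
    if v: "v \<in> carrier_vec (card \<Gamma>)" and "mat_adjoint B *\<^sub>v v = 0\<^sub>v n" for v
  proof -
    have "\<alpha> * (l2_norm v)\<^sup>2 \<le> (l2_norm (0\<^sub>v n))\<^sup>2"
      using block_bounds(1)[OF \<Gamma> v] that(2) by (simp add: B_def)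
    then have "\<alpha> * (l2_norm v)\<^sup>2 \<le> 0"
      using l2_norm_eq_0[of "0\<^sub>v n" n, THEN iffD2] by simp
    then have "(l2_norm v)\<^sup>2 \<le> 0" using \<alpha> by (simp add: mult_le_0_iff)
    then show ?thesis using l2_norm_eq_0[OF v] by simp
  qed
  from pinv_full_row_rank[OF B this] show "pinv B \<in> carrier_mat n (card \<Gamma>)"
    "B * pinv B = 1\<^sub>m (card \<Gamma>)" "mat_adjoint (pinv B * B) = pinv B * B" by blast+
qed

lemma step_carrier:
  "\<lbrakk>\<Gamma> \<in> T; x \<in> carrier_vec n\<rbrakk> \<Longrightarrow> kaczmarz_step A y \<Gamma> x \<in> carrier_vec n"
  by (rule kaczmarz_step_carrier[OF A block_subset _ block_pinv(1)])

lemma kaczmarz_carrier: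
  assumes "\<And>k. k < l \<Longrightarrow> s k \<in> T" "x0 \<in> carrier_vec n"
  shows "kaczmarz A y x0 s l \<in> carrier_vec n"
  using assms by (induction l) (auto intro: step_carrier)

text \<open>z is any vector with the measured moduli, so this single inequality covers every phase
  of \<open>xhat\<close>.\<close>

lemma step_bound:
  assumes \<Gamma>: "\<Gamma> \<in> T" and x: "x \<in> carrier_vec n" and z: "z \<in> carrier_vec n"
    and zy: "\<And>i. i < m \<Longrightarrow> (cmod ((A *\<^sub>v z) $ i))\<^sup>2 = y $ i"
  shows "(l2_norm (kaczmarz_step A y \<Gamma> x - z))\<^sup>2
    \<le> (l2_norm (x - z))\<^sup>2 - (\<Sum>i\<in>\<Gamma>. (cmod ((A *\<^sub>v (x - z)) $ i))\<^sup>2) / \<beta>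
      + 4 / \<alpha> * (\<Sum>i\<in>\<Gamma>. y $ i)"
proof -
  note sub = block_subset[OF \<Gamma>]
  define B where "B = row_block A \<Gamma>"
  have B: "B \<in> carrier_mat (card \<Gamma>) n" unfolding B_def by (rule row_block_carrier[OF A sub])
  define w where "w = Matrix.vec (dim_row B) (\<lambda>i. complex_of_real (sqrt (subvec y \<Gamma> $ i))
    * exp (\<i> * complex_of_real (map_vec Arg2pi (B *\<^sub>v x) $ i)))"
  have w: "w \<in> carrier_vec (card \<Gamma>)" using B by (simp add: w_def)
  have step: "kaczmarz_step A y \<Gamma> x = x + pinv B *\<^sub>v (w - B *\<^sub>v x)"
    by (simp add: kaczmarz_step_def Let_def w_def B_def)
  have fin: "finite \<Gamma>" using sub finite_subset by blast
  have entry: "(cmod ((w - B *\<^sub>v z) $ i))\<^sup>2 \<le> 4 * y $ pick \<Gamma> i" if i: "i < card \<Gamma>" for i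
  proof -
    have pick: "pick \<Gamma> i < m" using pick_in_set_le[OF i] sub by auto
    have set: "{i. i < dim_vec y \<and> i \<in> \<Gamma>} = \<Gamma>" using A y sub by auto
    have y0: "0 \<le> y $ pick \<Gamma> i" by (simp flip: zy[OF pick])
    have "cmod (w $ i) = sqrt (y $ pick \<Gamma> i)"
      using i B y0 set by (simp add: w_def subvec_def norm_mult)
    moreover have "cmod ((B *\<^sub>v z) $ i) = sqrt (y $ pick \<Gamma> i)"
      unfolding B_def row_block_mult_index[OF A sub i] by (simp flip: zy[OF pick])
    ultimately have "cmod ((w - B *\<^sub>v z) $ i) \<le> 2 * sqrt (y $ pick \<Gamma> i)"
      using i B w norm_triangle_ineq4[of "w $ i" "(B *\<^sub>v z) $ i"] by simp
    then have "(cmod ((w - B *\<^sub>v z) $ i))\<^sup>2 \<le> (2 * sqrt (y $ pick \<Gamma> i))\<^sup>2"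
      by (intro power_mono) auto
    then show ?thesis using y0 by (simp add: power_mult_distrib)
  qed
  have "(l2_norm (w - B *\<^sub>v z))\<^sup>2 \<le> (\<Sum>i<card \<Gamma>. 4 * y $ pick \<Gamma> i)"
    unfolding l2_norm_sq using B entry by (auto intro!: sum_mono)
  also have "\<dots> = 4 * (\<Sum>i\<in>\<Gamma>. y $ i)"
    using sum_pick[OF fin, of "\<lambda>i. y $ i"] by (simp flip: sum_distrib_left)
  finally have noise: "(l2_norm (w - B *\<^sub>v z))\<^sup>2 / \<alpha> \<le> 4 / \<alpha> * (\<Sum>i\<in>\<Gamma>. y $ i)"
    using \<alpha> by (simp add: divide_right_mono)
  have "(l2_norm (x + pinv B *\<^sub>v (w - B *\<^sub>v x) - z))\<^sup>2
    \<le> (l2_norm (x - z))\<^sup>2 - (l2_norm (B *\<^sub>v (x - z)))\<^sup>2 / \<beta> + (l2_norm (w - B *\<^sub>v z))\<^sup>2 / \<alpha>"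
    using block_step_norm_le[OF B _ _ _ \<alpha> \<beta> _ _ x z w] block_pinv[OF \<Gamma>] block_bounds[OF \<Gamma>]
    unfolding B_def by blast
  moreover have "(l2_norm (B *\<^sub>v (x - z)))\<^sup>2 = (\<Sum>i\<in>\<Gamma>. (cmod ((A *\<^sub>v (x - z)) $ i))\<^sup>2)"
    unfolding B_def by (rule l2_norm_row_block_mult[OF A sub])
  ultimately show ?thesis unfolding step using noise by simp
qed

section \<open>Averaging over the partition\<close>

lemma sigma_min_pos: "0 < sigma_min A"
  and sigma_min_le: "v \<in> carrier_vec n \<Longrightarrow> (sigma_min A)\<^sup>2 * (l2_norm v)\<^sup>2 \<le> (l2_norm (A *\<^sub>v v))\<^sup>2"
  using tall_sigma_min[OF A n_pos full_column_rank(2)[OF A rank] full_column_rank(1)[OF A rank]]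
  by blast+

lemma l2_norm_mult_sum_blocks:
  "(l2_norm (A *\<^sub>v v))\<^sup>2 = (\<Sum>\<Gamma>\<in>T. \<Sum>i\<in>\<Gamma>. (cmod ((A *\<^sub>v v) $ i))\<^sup>2)"
  using A by (subst sum_partition_on[OF part]) (auto simp: l2_norm_sq atLeast0LessThan)

text \<open>Test on one unit vector: sigma_min(A)^2 is at most its squared image norm under A, which
  splits into Nb block contributions of at most beta each.\<close>

lemma contraction_factor_nonneg: "0 \<le> 1 - (sigma_min A)\<^sup>2 / (\<beta> * real Nb)"
proof -
  let ?v = "unit_vec n 0 :: complex Matrix.vec"
  have v: "?v \<in> carrier_vec n" by simp
  have "(\<Sum>i<n. (cmod (?v $ i))\<^sup>2) = (\<Sum>i<n. if i = 0 then 1 else 0)"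
    by (intro sum.cong) (auto simp: unit_vec_def)
  then have v1: "(l2_norm ?v)\<^sup>2 = 1" using n_pos by (simp add: l2_norm_sq)
  have "(sigma_min A)\<^sup>2 \<le> (l2_norm (A *\<^sub>v ?v))\<^sup>2" using sigma_min_le[OF v] v1 by simp
  also have "\<dots> \<le> (\<Sum>\<Gamma>\<in>T. \<beta>)"
    unfolding l2_norm_mult_sum_blocks
  proof (rule sum_mono)
    fix \<Gamma> assume \<Gamma>: "\<Gamma> \<in> T"
    show "(\<Sum>i\<in>\<Gamma>. (cmod ((A *\<^sub>v ?v) $ i))\<^sup>2) \<le> \<beta>"
      using l2_norm_mult_le_adjoint[OF row_block_carrier[OF A block_subset[OF \<Gamma>]] v _ block_bounds(2)[OF \<Gamma>]]
        l2_norm_row_block_mult[OF A block_subset[OF \<Gamma>], of ?v] v1 \<beta> by simp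
  qed
  also have "\<dots> = \<beta> * real Nb" using card_T by simp
  finally show ?thesis using \<beta> Nb_pos by simp
qed

lemma average_step_bound:
  assumes x: "x \<in> carrier_vec n" and z: "z \<in> carrier_vec n"
    and zy: "\<And>i. i < m \<Longrightarrow> (cmod ((A *\<^sub>v z) $ i))\<^sup>2 = y $ i"
  shows "(\<Sum>\<Gamma>\<in>T. (l2_norm (kaczmarz_step A y \<Gamma> x - z))\<^sup>2) / real Nb
    \<le> (1 - (sigma_min A)\<^sup>2 / (\<beta> * real Nb)) * (l2_norm (x - z))\<^sup>2
      + 4 / (\<alpha> * real Nb) * l1_norm y"
proof -
  let ?D = "(l2_norm (x - z))\<^sup>2"
  have "l1_norm y = (\<Sum>i\<in>{0..<m}. y $ i)"
    using A unfolding l1_norm_def y by (intro sum.cong) auto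
  then have ysum: "(\<Sum>\<Gamma>\<in>T. \<Sum>i\<in>\<Gamma>. y $ i) = l1_norm y"
    by (simp add: sum_partition_on[OF part])
  have "(\<Sum>\<Gamma>\<in>T. (l2_norm (kaczmarz_step A y \<Gamma> x - z))\<^sup>2)
    \<le> (\<Sum>\<Gamma>\<in>T. ?D - (\<Sum>i\<in>\<Gamma>. (cmod ((A *\<^sub>v (x - z)) $ i))\<^sup>2) / \<beta> + 4 / \<alpha> * (\<Sum>i\<in>\<Gamma>. y $ i))"
    by (rule sum_mono) (rule step_bound[OF _ x z zy])
  also have "\<dots> = real Nb * ?D - (l2_norm (A *\<^sub>v (x - z)))\<^sup>2 / \<beta> + 4 / \<alpha> * l1_norm y"
    by (simp add: sum.distrib sum_subtractf card_T l2_norm_mult_sum_blocks ysum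
        flip: sum_divide_distrib sum_distrib_left)
  also have "\<dots> \<le> real Nb * ?D - (sigma_min A)\<^sup>2 * ?D / \<beta> + 4 / \<alpha> * l1_norm y"
    using sigma_min_le[of "x - z"] x z \<beta> by (simp add: divide_right_mono)
  also have "\<dots> = ((1 - (sigma_min A)\<^sup>2 / (\<beta> * real Nb)) * ?D + 4 / (\<alpha> * real Nb) * l1_norm y) * real Nb"
    using Nb_pos \<alpha> \<beta> by (simp add: field_simps)
  finally show ?thesis using Nb_pos by (simp add: divide_le_eq)
qed

text \<open>The averaged bound holds for every fixed phase of \<open>xhat\<close>; nonnegativity of the
  contraction factor lets it pass to the infimum over the phase.\<close>

lemma average_phase_dist_bound:
  assumes x: "x \<in> carrier_vec n"
  shows "(\<Sum>\<Gamma>\<in>T. (phase_dist (kaczmarz_step A y \<Gamma> x) xhat)\<^sup>2) / real Nb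
    \<le> (1 - (sigma_min A)\<^sup>2 / (\<beta> * real Nb)) * (phase_dist x xhat)\<^sup>2
      + 4 / (\<alpha> * real Nb) * l1_norm y"
proof -
  let ?L = "(\<Sum>\<Gamma>\<in>T. (phase_dist (kaczmarz_step A y \<Gamma> x) xhat)\<^sup>2) / real Nb"
  let ?q = "1 - (sigma_min A)\<^sup>2 / (\<beta> * real Nb)" and ?c = "4 / (\<alpha> * real Nb) * l1_norm y"
  let ?z = "\<lambda>\<theta>. exp (\<i> * complex_of_real \<theta>) \<cdot>\<^sub>v xhat"
  have le: "?L \<le> ?q * (l2_norm (x - ?z \<theta>))\<^sup>2 + ?c" if \<theta>: "\<theta> \<in> {0..<2 * pi}" for \<theta>
  proof -
    have "A *\<^sub>v ?z \<theta> = exp (\<i> * complex_of_real \<theta>) \<cdot>\<^sub>v (A *\<^sub>v xhat)"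
      using A xhat by (simp add: mult_mat_vec)
    then have zy: "(cmod ((A *\<^sub>v ?z \<theta>) $ i))\<^sup>2 = y $ i" if "i < m" for i
      using that A unfolding y by (simp add: norm_mult)
    have "?L \<le> (\<Sum>\<Gamma>\<in>T. (l2_norm (kaczmarz_step A y \<Gamma> x - ?z \<theta>))\<^sup>2) / real Nb"
      by (intro divide_right_mono sum_mono power_mono phase_dist_le[OF \<theta>] phase_dist_nonneg) simp
    also have "\<dots> \<le> ?q * (l2_norm (x - ?z \<theta>))\<^sup>2 + ?c"
      by (rule average_step_bound[OF x _ zy]) (use xhat in auto)
    finally show ?thesis .
  qed
  show ?thesis
  proof (cases "?q = 0")
    \<comment> \<open>Division by q is impossible here, but then the phase has dropped out of the
      bound and the phase 0 will do.\<close>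
    case True
    have "?L \<le> ?q * (l2_norm (x - ?z 0))\<^sup>2 + ?c" using pi_gt_zero by (intro le) simp
    then show ?thesis unfolding True by simp
  next
    case False
    then have q: "0 < ?q" using contraction_factor_nonneg by linarith
    \<comment> \<open>\<open>phase_dist\<close> is an infimum of norms, not of their squares, hence
      the root. The quotient may be negative; this is harmless, as \<open>sqrt\<close> is extended
      to the negative reals as an odd function.\<close>
    have "sqrt ((?L - ?c) / ?q) \<le> phase_dist x xhat"
      unfolding phase_dist_def[of x]
    proof (rule cINF_greatest)
      show "{0..<2 * pi} \<noteq> {}" using pi_gt_zero by simp
      fix \<theta> :: real assume "\<theta> \<in> {0..<2 * pi}"
      then have "(?L - ?c) / ?q \<le> (l2_norm (x - ?z \<theta>))\<^sup>2"
        using le[of \<theta>] by (subst pos_divide_le_eq[OF q]) (simp add: mult.commute)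
      then show "sqrt ((?L - ?c) / ?q) \<le> l2_norm (x - ?z \<theta>)"
        by (rule real_le_lsqrt[rotated]) simp
    qed
    then have "(?L - ?c) / ?q \<le> (phase_dist x xhat)\<^sup>2" by (rule sqrt_le_D)
    then have "?L - ?c \<le> (phase_dist x xhat)\<^sup>2 * ?q" by (subst (asm) pos_divide_le_eq[OF q])
    then show ?thesis by (simp add: mult.commute)
  qed
qed

end

section \<open>Averaging over the random blocks\<close>

context prob_space
begin

text \<open>Measurability into \<open>count_space T\<close> already confines every draw to T on the
  whole space, not merely almost surely.\<close>

lemma
  assumes T: "finite T" and iid: "iid_uniform_blocks M T \<Gamma>s"
  shows block_in_T: "\<omega> \<in> space M \<Longrightarrow> \<Gamma>s k \<omega> \<in> T"
    and prefix_measurable: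
      "(\<lambda>\<omega>. restrict (\<lambda>k. \<Gamma>s k \<omega>) I) \<in> measurable M (PiM I (\<lambda>_. count_space T))"
    and prob_block: "\<Gamma> \<in> T \<Longrightarrow> prob {\<omega> \<in> space M. \<Gamma>s k \<omega> = \<Gamma>} = 1 / card T"
proof -
  have rv: "\<Gamma>s k \<in> measurable M (count_space T)" for k
    using iid by (auto simp: iid_uniform_blocks_def indep_vars_def)
  show "\<Gamma>s k \<omega> \<in> T" if "\<omega> \<in> space M" using measurable_space[OF rv that] by simp
  show "(\<lambda>\<omega>. restrict (\<lambda>k. \<Gamma>s k \<omega>) I) \<in> measurable M (PiM I (\<lambda>_. count_space T))"
    using rv by (intro measurable_restrict)
  assume \<Gamma>: "\<Gamma> \<in> T"
  have "prob {\<omega> \<in> space M. \<Gamma>s k \<omega> = \<Gamma>} = measure (distr M (count_space T) (\<Gamma>s k)) {\<Gamma>}"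
    using \<Gamma> by (subst measure_distr[OF rv]) (auto intro!: arg_cong[where f = prob])
  also have "\<dots> = 1 / card T"
    using iid T \<Gamma> by (simp add: iid_uniform_blocks_def measure_uniform_count_measure)
  finally show "prob {\<omega> \<in> space M. \<Gamma>s k \<omega> = \<Gamma>} = 1 / card T" .
qed

text \<open>A function of the first l draws factors through the finite set of prefixes, whose
  product sigma-algebra is discrete; so it is measurable and bounded whatever f is.\<close>

lemma integrable_prefix:
  fixes f :: "(nat \<Rightarrow> nat set) \<Rightarrow> real"
  assumes T: "finite T" and iid: "iid_uniform_blocks M T \<Gamma>s"
    and dep: "\<And>s s'. (\<And>k. k < l \<Longrightarrow> s k = s' k) \<Longrightarrow> f s = f s'"
  shows "integrable M (\<lambda>\<omega>. f (\<lambda>k. \<Gamma>s k \<omega>))"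
proof -
  let ?P = "PiE {..<l} (\<lambda>_. T)"
  let ?X = "\<lambda>\<omega>. restrict (\<lambda>k. \<Gamma>s k \<omega>) {..<l}"
  \<comment> \<open>\<open>restrict\<close> makes the later coordinates \<open>undefined\<close>,
    which f cannot notice.\<close>
  have eq: "f (\<lambda>k. \<Gamma>s k \<omega>) = f (?X \<omega>)" for \<omega> by (rule dep) simp
  have PiM: "PiM {..<l} (\<lambda>_. count_space T) = count_space ?P"
    by (rule count_space_PiM_finite) (simp_all add: T countable_finite)
  have X: "?X \<in> measurable M (count_space ?P)"
    using prefix_measurable[OF T iid, of "{..<l}"] unfolding PiM .
  have fin: "finite ?P" using T by (simp add: finite_PiE)
  show ?thesis
    unfolding eq
  proof (rule integrable_const_bound)
    show "AE \<omega> in M. norm (f (?X \<omega>)) \<le> (\<Sum>s\<in>?P. \<bar>f s\<bar>)"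
    proof (rule AE_I2)
      fix \<omega> assume "\<omega> \<in> space M"
      then have "?X \<omega> \<in> ?P" using measurable_space[OF X] by simp
      then show "norm (f (?X \<omega>)) \<le> (\<Sum>s\<in>?P. \<bar>f s\<bar>)"
        using member_le_sum[of "?X \<omega>" ?P "\<lambda>s. \<bar>f s\<bar>"] fin by simp
    qed
    show "(\<lambda>\<omega>. f (?X \<omega>)) \<in> borel_measurable M"
      by (rule measurable_compose[OF X]) simp
  qed
qed

text \<open>This replaces conditioning on the past. Splitting by the value of draw l writes the
  integrand as a sum of products of a function of the prefix and an indicator of draw l;
  independence factors each product, and each indicator has mean 1 / card T.\<close>

lemma integral_average_last_draw:
  fixes g :: "(nat \<Rightarrow> nat set) \<Rightarrow> nat set \<Rightarrow> real"
  assumes T: "finite T" and iid: "iid_uniform_blocks M T \<Gamma>s"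
    and dep: "\<And>s s' \<Gamma>. (\<And>k. k < l \<Longrightarrow> s k = s' k) \<Longrightarrow> g s \<Gamma> = g s' \<Gamma>"
  shows "(\<integral>\<omega>. g (\<lambda>k. \<Gamma>s k \<omega>) (\<Gamma>s l \<omega>) \<partial>M)
    = (\<integral>\<omega>. (\<Sum>\<Gamma>\<in>T. g (\<lambda>k. \<Gamma>s k \<omega>) \<Gamma>) / card T \<partial>M)"
proof -
  let ?N = "\<lambda>_::nat. count_space T"
  let ?X = "\<lambda>I \<omega>. restrict (\<lambda>k. \<Gamma>s k \<omega>) I"
  have PiM: "PiM I ?N = count_space (PiE I (\<lambda>_. T))" if "finite I" for I
    using that by (rule count_space_PiM_finite) (simp add: T countable_finite)
  \<comment> \<open>Mutual independence of all draws gives independence of the two groups because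
    {..<l} and {l} are disjoint.\<close>
  have ind: "indep_var (PiM {..<l} ?N) (?X {..<l}) (PiM {l} ?N) (?X {l})"
    using iid by (intro indep_var_restrict[of _ _ UNIV]) (auto simp: iid_uniform_blocks_def)
  have int_g: "integrable M (\<lambda>\<omega>. g (\<lambda>k. \<Gamma>s k \<omega>) \<Gamma>)" for \<Gamma>
    using integrable_prefix[OF T iid, of l "\<lambda>s. g s \<Gamma>"] dep by blast
  let ?I = "\<lambda>\<Gamma> \<omega>. if \<Gamma>s l \<omega> = \<Gamma> then 1 else 0 :: real"
  have int_I: "integrable M (?I \<Gamma>)" for \<Gamma>
    using integrable_prefix[OF T iid, of "Suc l" "\<lambda>s. if s l = \<Gamma> then 1 else 0"] by simp
  have indep: "indep_var borel (\<lambda>\<omega>. g (\<lambda>k. \<Gamma>s k \<omega>) \<Gamma>) borel (?I \<Gamma>)" for \<Gamma>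
  proof -
    have "indep_var borel ((\<lambda>s. g s \<Gamma>) \<circ> ?X {..<l}) borel ((\<lambda>s. if s l = \<Gamma> then 1 else 0 :: real) \<circ> ?X {l})"
      by (rule indep_var_compose[OF ind]) (simp_all add: PiM)
    moreover have "(\<lambda>s. g s \<Gamma>) \<circ> ?X {..<l} = (\<lambda>\<omega>. g (\<lambda>k. \<Gamma>s k \<omega>) \<Gamma>)"
      by (rule ext) (auto intro: dep)
    moreover have "(\<lambda>s. if s l = \<Gamma> then 1 else 0 :: real) \<circ> ?X {l} = ?I \<Gamma>"
      by (rule ext) simp
    ultimately show ?thesis by simp
  qed
  have E_I: "(\<integral>\<omega>. ?I \<Gamma> \<omega> \<partial>M) = 1 / card T" if \<Gamma>: "\<Gamma> \<in> T" for \<Gamma>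
  proof -
    have "(\<integral>\<omega>. ?I \<Gamma> \<omega> \<partial>M) = (\<integral>\<omega>. indicator {\<omega> \<in> space M. \<Gamma>s l \<omega> = \<Gamma>} \<omega> \<partial>M)"
      by (intro Bochner_Integration.integral_cong) (auto simp: indicator_def)
    also have "\<dots> = prob {\<omega> \<in> space M. \<Gamma>s l \<omega> = \<Gamma>}"
      by (simp add: Int_absorb2 Collect_restrict flip: Int_def)
    finally show ?thesis using prob_block[OF T iid \<Gamma>] by simp
  qed
  have "(\<integral>\<omega>. g (\<lambda>k. \<Gamma>s k \<omega>) (\<Gamma>s l \<omega>) \<partial>M) = (\<integral>\<omega>. (\<Sum>\<Gamma>\<in>T. g (\<lambda>k. \<Gamma>s k \<omega>) \<Gamma> * ?I \<Gamma> \<omega>) \<partial>M)"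
    using block_in_T[OF T iid] T by (intro Bochner_Integration.integral_cong) (auto simp: if_distrib cong: if_cong)
  also have "\<dots> = (\<Sum>\<Gamma>\<in>T. (\<integral>\<omega>. g (\<lambda>k. \<Gamma>s k \<omega>) \<Gamma> * ?I \<Gamma> \<omega> \<partial>M))"
    by (rule Bochner_Integration.integral_sum) (rule indep_var_integrable[OF indep int_g int_I])
  also have "\<dots> = (\<Sum>\<Gamma>\<in>T. (\<integral>\<omega>. g (\<lambda>k. \<Gamma>s k \<omega>) \<Gamma> \<partial>M) * (1 / card T))"
    using indep_var_lebesgue_integral[OF indep int_g int_I] E_I by (intro sum.cong) auto
  also have "\<dots> = (\<integral>\<omega>. (\<Sum>\<Gamma>\<in>T. g (\<lambda>k. \<Gamma>s k \<omega>) \<Gamma>) / card T \<partial>M)"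
    using int_g by (simp add: sum_divide_distrib)
  finally show ?thesis .
qed

end

section \<open>The recursion for the expected error\<close>

lemma kaczmarz_cong:
  "(\<And>k. k < l \<Longrightarrow> s k = s' k) \<Longrightarrow> kaczmarz A y x0 s l = kaczmarz A y x0 s' l"
  by (induction l) auto

theorem theorem2p6:
  fixes A :: "complex mat" and m n Nb l :: nat and \<alpha> \<beta> :: real
    and y :: "real Matrix.vec" and xhat x0 :: "complex Matrix.vec"
    and T :: "nat set set" and M :: "'w measure" and \<Gamma>s :: "nat \<Rightarrow> 'w \<Rightarrow> nat set"
  assumes "A \<in> carrier_mat m n"
    and "\<And>i. i < m \<Longrightarrow> l2_norm (row A i) = 1"
    and "vec_space.rank m A = n"
    and "xhat \<in> carrier_vec n"
    and "y = map_vec (\<lambda>z. (cmod z)\<^sup>2) (A *\<^sub>v xhat)"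
    and "row_paving A Nb \<alpha> \<beta> T"
    and "\<alpha> > 0"
    and "\<And>\<Gamma>. \<Gamma> \<in> T \<Longrightarrow> card \<Gamma> \<le> n"
    and "x0 \<in> carrier_vec n"
    and "prob_space M"
    and "iid_uniform_blocks M T \<Gamma>s"
  shows "(\<integral>\<omega>. (phase_dist (kaczmarz A y x0 (\<lambda>k. \<Gamma>s k \<omega>) l) xhat)\<^sup>2 \<partial>M)
    \<le> (1 - (sigma_min A)\<^sup>2 / (\<beta> * real Nb)) ^ l * (phase_dist x0 xhat)\<^sup>2
       + 4 * \<beta> / (\<alpha> * (sigma_min A)\<^sup>2) * l1_norm y"
proof -
  interpret prob_space M by fact
  note iid = assms(11)
  have fin: "finite T"
    using assms(6) by (auto simp: row_paving_def intro: finite_elements)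
  have in_T: "\<Gamma>s k \<omega> \<in> T" if "\<omega> \<in> space M" for k \<omega>
    using block_in_T[OF fin iid that] .
  \<comment> \<open>A probability space has a sample point, and the block drawn there is an element
    of T.\<close>
  have "T \<noteq> {}" using in_T not_empty by blast
  then interpret phase_retrieval_paving A m n Nb \<alpha> \<beta> y xhat T
    using assms by unfold_locales
  define q where "q = 1 - (sigma_min A)\<^sup>2 / (\<beta> * real Nb)"
  define c where "c = 4 / (\<alpha> * real Nb) * l1_norm y"
  define C where "C = 4 * \<beta> / (\<alpha> * (sigma_min A)\<^sup>2) * l1_norm y"
  define X where "X s l = kaczmarz A y x0 s l" for s l
  have q: "0 \<le> q" unfolding q_def by (rule contraction_factor_nonneg)
  have C: "0 \<le> C" using \<alpha> \<beta> by (simp add: C_def l1_norm_def sum_nonneg)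
  \<comment> \<open>C is invariant under e -> q e + c, so only the excess over C evolves in the
    induction, and it shrinks by the factor q.\<close>
  have fixpoint: "q * C + c = C"
    using \<alpha> \<beta> Nb_pos sigma_min_pos by (simp add: q_def c_def C_def field_simps)
  have Xdep: "X s l = X s' l" if "\<And>k. k < l \<Longrightarrow> s k = s' k" for s s' l
    unfolding X_def using that by (rule kaczmarz_cong)
  have "(\<integral>\<omega>. (phase_dist (X (\<lambda>k. \<Gamma>s k \<omega>) l) xhat)\<^sup>2 \<partial>M) \<le> q ^ l * (phase_dist x0 xhat)\<^sup>2 + C"
  proof (induction l)
    case 0
    then show ?case using C by (simp add: X_def prob_space)
  next
    case (Suc l)
    \<comment> \<open>Separating the past s from the block drawn next lets that block be averaged
      with the past held fixed.\<close>
    let ?g = "\<lambda>s \<Gamma>. (phase_dist (kaczmarz_step A y \<Gamma> (X s l)) xhat)\<^sup>2"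
    have int: "integrable M (\<lambda>\<omega>. (phase_dist (X (\<lambda>k. \<Gamma>s k \<omega>) l) xhat)\<^sup>2)"
      by (rule integrable_prefix[OF fin iid, of l]) (simp cong: Xdep)
    have int_g: "integrable M (\<lambda>\<omega>. (\<Sum>\<Gamma>\<in>T. ?g (\<lambda>k. \<Gamma>s k \<omega>) \<Gamma>) / real Nb)"
      by (rule integrable_prefix[OF fin iid, of l]) (simp cong: Xdep)
    have "(\<integral>\<omega>. (phase_dist (X (\<lambda>k. \<Gamma>s k \<omega>) (Suc l)) xhat)\<^sup>2 \<partial>M)
      = (\<integral>\<omega>. ?g (\<lambda>k. \<Gamma>s k \<omega>) (\<Gamma>s l \<omega>) \<partial>M)" by (simp add: X_def)
    also have "\<dots> = (\<integral>\<omega>. (\<Sum>\<Gamma>\<in>T. ?g (\<lambda>k. \<Gamma>s k \<omega>) \<Gamma>) / real Nb \<partial>M)"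
      unfolding card_T[symmetric]
      by (rule integral_average_last_draw[OF fin iid]) (simp cong: Xdep)
    also have "\<dots> \<le> (\<integral>\<omega>. q * (phase_dist (X (\<lambda>k. \<Gamma>s k \<omega>) l) xhat)\<^sup>2 + c \<partial>M)"
    proof (rule integral_mono[OF int_g])
      show "integrable M (\<lambda>\<omega>. q * (phase_dist (X (\<lambda>k. \<Gamma>s k \<omega>) l) xhat)\<^sup>2 + c)"
        using int by simp
      fix \<omega> assume "\<omega> \<in> space M"
      then have "X (\<lambda>k. \<Gamma>s k \<omega>) l \<in> carrier_vec n"
        unfolding X_def using in_T assms(9) by (intro kaczmarz_carrier)
      then show "(\<Sum>\<Gamma>\<in>T. ?g (\<lambda>k. \<Gamma>s k \<omega>) \<Gamma>) / real Nb \<le> q * (phase_dist (X (\<lambda>k. \<Gamma>s k \<omega>) l) xhat)\<^sup>2 + c"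
        unfolding q_def c_def by (rule average_phase_dist_bound)
    qed
    also have "\<dots> = q * (\<integral>\<omega>. (phase_dist (X (\<lambda>k. \<Gamma>s k \<omega>) l) xhat)\<^sup>2 \<partial>M) + c"
      using int by (simp add: prob_space)
    also have "\<dots> \<le> q * (q ^ l * (phase_dist x0 xhat)\<^sup>2 + C) + c"
      using Suc.IH q by (simp add: mult_left_mono)
    also have "\<dots> = q ^ Suc l * (phase_dist x0 xhat)\<^sup>2 + C"
      using fixpoint by (simp add: algebra_simps)
    finally show ?case .
  qed
  then show ?thesis by (simp only: X_def q_def C_def)
qed

end
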